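(* For all $\varepsilon >0$ and all integers $k\geq 3$, there exists $N \in \mathbb{N}$ such that for all coprime integers $m$ and $n$ with $n > N$ and $\ln \ln n < m < \ln n$, there exists a permutation $f \in \mathrm{Sym}( \mathbb{Z} /n\mathbb{Z})$ of order dividing $k$ such that $f(x+1) = m f(x)$ for at least $(1-\varepsilon)n$ values of $x \in \mathbb{Z}/n\mathbb{Z}$.
   Context: $\mathrm{Sym}(X)$ denotes the group of all permutations of the set $X$. A permutation $f$ has order dividing $k$ when $f^k=\mathrm{id}$. In $f(x+1)=mf(x)$, addition and multiplication are those of the ring $\mathbb{Z}/n\mathbb{Z}$. *)

theory Defs
  imports Complex_Main "HOL-Number_Theory.Residues" "HOL-Combinatorics.Permutations"
begin

text \<open>
  \<open>residue_ring n\<close> represents \<open>\<int>/n\<int>\<close> on the carrier \<open>{0..n - 1}\<close>, so the integer \<open>m\<close> acts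
  through its representative \<open>m mod n\<close>. The successor \<open>x + 1\<close> is taken in the ring, hence wraps
  around at \<open>n - 1\<close>. The ring's own \<open>\<one>\<close> is the integer \<open>1\<close>, which is not in the carrier when
  \<open>n = 1\<close>; sums are nevertheless reduced modulo \<open>n\<close>.
\<close>

definition twisted_shift_points :: "int \<Rightarrow> int \<Rightarrow> (int \<Rightarrow> int) \<Rightarrow> int set" where
  "twisted_shift_points n m f =
     {x \<in> carrier (residue_ring n).
        f (x \<oplus>\<^bsub>residue_ring n\<^esub> \<one>\<^bsub>residue_ring n\<^esub>)
          = (m mod n) \<otimes>\<^bsub>residue_ring n\<^esub> f x}"

end

theory Submission
  imports Defs
begin

text \<open>
  Write \<open>S\<close> for \<open>x \<mapsto> x + 1\<close> and \<open>T\<close> for \<open>x \<mapsto> m x\<close> on \<open>\<int>/n\<int>\<close>. For large \<open>m\<close> these two maps look locally like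
  the lamplighter group \<open>\<int> \<wr> \<int>\<close> with lamp generator \<open>S\<close>: away from carries, \<open>T\<^sup>j S T\<^sup>-\<^sup>j\<close> adds \<open>1\<close> to the
  \<open>j\<close>-th digit in base \<open>m\<close>. Accordingly, \<open>\<int>/n\<int>\<close> is covered up to a small proportion, and almost
  disjointly, by copies of one tile \<open>P\<close> (digit strings of length \<open>L\<close> together with a level \<open>j < L\<close>), on
  which \<open>S\<close> and \<open>T\<close> act as partial injections \<open>\<alpha>\<close> and \<open>\<beta>\<close>.

  The tiles come from a Rokhlin tower for \<open>T\<close>, which acts on leading digits as a Bernoulli shift. Mark
  the points with leading digit below \<open>g \<approx> \<delta> m\<close>; the base of the tower consists of the points whose
  time to the first mark is a multiple of \<open>L\<close>. Most points meet a mark within a bounded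
  number \<open>R\<close> of steps, so the base is determined by the \<open>R\<close> leading digits and is essentially a union of
  intervals of length \<open>m\<^sup>L\<close>.

  On the other hand, \<open>P\<^sup>k\<close> carries the cyclic rotation \<open>F\<close>, of order \<open>k\<close>, and \<open>F A = B F\<close> for \<open>A\<close> acting by \<open>\<alpha>\<close>
  and \<open>\<beta>\<close> on the first two factors and \<open>B\<close> by \<open>\<beta>\<close> and \<open>\<alpha>\<close> on the first and the last one. As \<open>k \<ge> 3\<close>,
  a change of coordinates turns \<open>A\<close> and \<open>B\<close> into \<open>\<alpha>\<close> and \<open>\<beta>\<close> on the first factor alone, that is, into
  \<open>S\<close> and \<open>T\<close> on a family of \<open>|P|\<^sup>k\<^sup>-\<^sup>1\<close> tiles. This is where \<open>m < ln n\<close> enters: \<open>|P|\<^sup>k\<close>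
  is polynomial in \<open>m\<close>, hence negligible compared with \<open>n\<close>.
\<close>

section \<open>Rotating tiles\<close>

text \<open>The complements of \<open>A\<close> and of its image in the finite set \<open>P\<close>
  have equal size, so any bijection between them completes \<open>f\<close>.\<close>

lemma partial_injection_extends_to_bij:
  assumes "finite P" "A \<subseteq> P" "inj_on f A" "f ` A \<subseteq> P"
  obtains g where "bij_betw g P P" "\<And>x. x \<in> A \<Longrightarrow> g x = f x"
proof -
  have "card (P - A) = card (P - f ` A)"
    using assms by (simp add: card_Diff_subset finite_subset card_image)
  then obtain h where h: "bij_betw h (P - A) (P - f ` A)"
    using assms(1) finite_same_card_bij[of "P - A" "P - f ` A"] by auto
  define g where "g x = (if x \<in> A then f x else h x)" for x
  have "bij_betw g A (f ` A)"
    using assms(3) by (simp add: bij_betw_def inj_on_def g_def)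
  moreover have "bij_betw g (P - A) (P - f ` A)"
    using h bij_betw_cong[of "P - A" g h] by (simp add: g_def)
  ultimately have "bij_betw g (A \<union> (P - A)) (f ` A \<union> (P - f ` A))"
    by (rule bij_betw_combine) auto
  moreover have "A \<union> (P - A) = P" "f ` A \<union> (P - f ` A) = P"
    using assms by auto
  ultimately show ?thesis
    using that[of g] by (simp add: g_def)
qed

lemma bij_betw_funpow_mem:
  assumes "bij_betw g P P" "x \<in> P"
  shows "(g ^^ i) x \<in> P"
  using assms(2) by (induction i) (auto intro: bij_betwE[OF assms(1), rule_format])

lemma bij_betw_funpow_eq_iff:
  assumes "bij_betw g P P" "x \<in> P" "y \<in> P"
  shows "(g ^^ i) x = (g ^^ i) y \<longleftrightarrow> x = y"
  using bij_betw_funpow[OF assms(1), of i] assms(2,3) by (auto simp: bij_betw_def inj_on_def)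

text \<open>The counters \<open>h\<close> and \<open>w\<close> of the first factor of \<open>P\<^sup>k\<close> say how often to apply \<open>\<beta>\<close> to the second
  and \<open>\<alpha>\<close> to the last factor in order to undo the companions of \<open>\<alpha>\<close> and \<open>\<beta>\<close>; see \<open>tw\<close> below.\<close>

lemma twisted_rotation_exists:
  fixes \<alpha> \<beta> :: "'p \<Rightarrow> 'p" and h w :: "'p \<Rightarrow> nat" and Q :: "'q set"
  assumes P: "finite P" and k: "k \<ge> 3"
    and a: "A \<subseteq> P" "inj_on \<alpha> A" "\<alpha> ` A \<subseteq> P"
    and b: "B \<subseteq> P" "inj_on \<beta> B" "\<beta> ` B \<subseteq> P"
    and ha: "\<And>p. p \<in> A \<Longrightarrow> h p = Suc (h (\<alpha> p))" and wa: "\<And>p. p \<in> A \<Longrightarrow> w (\<alpha> p) = w p"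
    and hb: "\<And>p. p \<in> B \<Longrightarrow> h (\<beta> p) = h p" and wb: "\<And>p. p \<in> B \<Longrightarrow> w p = Suc (w (\<beta> p))"
    and Q: "finite Q" "card Q = card P ^ (k - 1) * t"
  obtains F where "bij_betw F (P \<times> Q) (P \<times> Q)" "\<And>z. z \<in> P \<times> Q \<Longrightarrow> (F ^^ k) z = z"
    "\<And>p q p' q'. \<lbrakk>p \<in> A; q \<in> Q; F (p, q) = (p', q'); p' \<in> B\<rbrakk> \<Longrightarrow> F (\<alpha> p, q) = (\<beta> p', q')"
proof -
  obtain a' where a': "bij_betw a' P P" "\<And>x. x \<in> A \<Longrightarrow> a' x = \<alpha> x"
    using partial_injection_extends_to_bij[OF P a] by metis
  obtain b' where b': "bij_betw b' P P" "\<And>x. x \<in> B \<Longrightarrow> b' x = \<beta> x"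
    using partial_injection_extends_to_bij[OF P b] by metis
  define Z where "Z = {zs. set zs \<subseteq> P \<and> length zs = k - 1}"
  define Y where "Y = {ys. set ys \<subseteq> P \<and> length ys = k}"
  have finZ: "finite Z" and cZ: "card Z = card P ^ (k - 1)"
    using P by (simp_all add: Z_def card_lists_length_eq finite_lists_length_eq)
  have finY: "finite Y" and cY: "card Y = card P ^ k"
    using P by (simp_all add: Y_def card_lists_length_eq finite_lists_length_eq)
  have "card (Z \<times> {..<t}) = card Q"
    using Q cZ by (simp add: card_cartesian_product)
  \<comment> \<open>\<open>Q\<close> is labelled by the last \<open>k - 1\<close> factors together
    with a copy number below \<open>t\<close>.\<close>
  then obtain \<eta> where \<eta>: "bij_betw \<eta> (Z \<times> {..<t}) Q"
    using Q finZ finite_same_card_bij[of "Z \<times> {..<t}" Q] by auto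
  \<comment> \<open>Entry \<open>0\<close> of \<open>zs\<close> is the second factor and entry
    \<open>k - 2\<close> the last one; they differ because \<open>k \<ge> 3\<close>, so the two
    corrections do not interfere.\<close>
  define tw where "tw p zs = zs[0 := (b' ^^ h p) (zs ! 0), k - 2 := (a' ^^ w p) (zs ! (k - 2))]"
    for p and zs
  have tw_Z: "tw p zs \<in> Z" if "zs \<in> Z" for p zs
  proof -
    have "zs ! 0 \<in> P" "zs ! (k - 2) \<in> P"
      using that k by (auto simp: Z_def subset_iff)
    then have "(b' ^^ h p) (zs ! 0) \<in> P" "(a' ^^ w p) (zs ! (k - 2)) \<in> P"
      using bij_betw_funpow_mem a'(1) b'(1) by metis+
    then show ?thesis
      using that unfolding tw_def Z_def
      by (auto intro!: set_update_subsetI dest!: subsetD[OF set_update_subset_insert])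
  qed
  have tw_inj: "zs = us" if "tw p zs = tw p us" "zs \<in> Z" "us \<in> Z" for p zs us
  proof (rule nth_equalityI)
    show len: "length zs = length us" using that by (simp add: Z_def)
    fix i assume i: "i < length zs"
    have eq: "tw p zs ! i = tw p us ! i" using that by simp
    have lens: "0 < length us" "k - 2 < length us" "length zs = length us"
      using len that k by (simp_all add: Z_def)
    have mem: "zs ! i \<in> P" "us ! i \<in> P"
      using i len that by (auto simp: Z_def subset_iff)
    show "zs ! i = us ! i"
      using eq i lens mem
      by (auto simp: tw_def nth_list_update bij_betw_funpow_eq_iff[OF a'(1)]
            bij_betw_funpow_eq_iff[OF b'(1)] split: if_splits)
  qed
  \<comment> \<open>The change of coordinates: the first factor stays visible, the others are
    twisted by its counters and hidden in the label.\<close>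
  define \<Phi> where "\<Phi> = (\<lambda>(ys, i). (hd ys, \<eta> (tw (hd ys) (tl ys), i)))"
  have Y_Cons: "ys \<in> Y \<longleftrightarrow> (\<exists>p zs. ys = p # zs \<and> p \<in> P \<and> zs \<in> Z)" for ys
    using k by (cases ys) (auto simp: Y_def Z_def)
  have \<Phi>_Cons: "\<Phi> (p # zs, i) = (p, \<eta> (tw p zs, i))" for p zs i
    by (simp add: \<Phi>_def)
  have \<Phi>: "bij_betw \<Phi> (Y \<times> {..<t}) (P \<times> Q)"
  proof -
    have "inj_on \<Phi> (Y \<times> {..<t})"
    proof (rule inj_onI, clarify)
      fix ys i us j
      assume ys: "ys \<in> Y" "i < t" and us: "us \<in> Y" "j < t" and eq: "\<Phi> (ys, i) = \<Phi> (us, j)"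
      obtain p zs where 1: "ys = p # zs" "zs \<in> Z" using ys Y_Cons by blast
      obtain p' zs' where 2: "us = p' # zs'" "zs' \<in> Z" using us Y_Cons by blast
      have pp: "p = p'" and "\<eta> (tw p zs, i) = \<eta> (tw p zs', j)"
        using eq by (auto simp: 1 2 \<Phi>_Cons)
      then have "(tw p zs, i) = (tw p zs', j)"
        using \<eta> 1 2 ys us tw_Z unfolding bij_betw_def inj_on_def by blast
      then show "ys = us \<and> i = j"
        using tw_inj 1 2 pp by auto
    qed
    moreover have "\<Phi> ` (Y \<times> {..<t}) \<subseteq> P \<times> Q"
      using \<eta> tw_Z by (fastforce simp: Y_Cons \<Phi>_Cons bij_betw_def)
    moreover have "card (Y \<times> {..<t}) = card (P \<times> Q)"
      using k by (simp add: card_cartesian_product cY Q(2) power_eq_if)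
    ultimately show ?thesis
      using P Q(1) by (metis bij_betw_def card_image card_subset_eq finite_cartesian_product)
  qed
  define \<Psi> where "\<Psi> = inv_into (Y \<times> {..<t}) \<Phi>"
  have \<Psi>: "bij_betw \<Psi> (P \<times> Q) (Y \<times> {..<t})"
    using \<Phi> by (simp add: \<Psi>_def bij_betw_inv_into)
  have \<Psi>\<Phi>: "\<Psi> (\<Phi> u) = u" if "u \<in> Y \<times> {..<t}" for u
    using \<Phi> that unfolding \<Psi>_def by (rule bij_betw_inv_into_left)
  have \<Phi>\<Psi>: "\<Phi> (\<Psi> z) = z" if "z \<in> P \<times> Q" for z
    using \<Phi> that unfolding \<Psi>_def by (rule bij_betw_inv_into_right)
  define \<rho> :: "'p list \<times> nat \<Rightarrow> 'p list \<times> nat" where "\<rho> = (\<lambda>(ys, i). (rotate1 ys, i))"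
  have \<rho>_mem: "\<rho> u \<in> Y \<times> {..<t}" if "u \<in> Y \<times> {..<t}" for u
    using that by (auto simp: \<rho>_def Y_def)
  have \<rho>_bij: "bij_betw \<rho> (Y \<times> {..<t}) (Y \<times> {..<t})"
  proof -
    have "inj_on \<rho> (Y \<times> {..<t})"
      using inj_rotate1 by (auto simp: \<rho>_def inj_on_def inj_def)
    then show ?thesis
      using \<rho>_mem finY by (simp add: bij_betw_def endo_inj_surj image_subset_iff)
  qed
  have \<rho>_pow: "(\<rho> ^^ j) (ys, i) = (rotate j ys, i)" for j ys i
    by (induction j) (simp_all add: \<rho>_def rotate_def)
  define F where "F = \<Phi> \<circ> (\<rho> \<circ> \<Psi>)"
  have F_bij: "bij_betw F (P \<times> Q) (P \<times> Q)"
    unfolding F_def by (intro bij_betw_trans[OF bij_betw_trans[OF \<Psi> \<rho>_bij] \<Phi>])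
  moreover have "(F ^^ k) z = z" if "z \<in> P \<times> Q" for z
  proof -
    have "\<Psi> z \<in> Y \<times> {..<t}" using \<Psi> that by (rule bij_betw_apply)
    then obtain ys i where ys: "\<Psi> z = (ys, i)" "ys \<in> Y" "i < t" by auto
    have z: "\<Phi> (ys, i) = z" using \<Phi>\<Psi>[OF that] ys by simp
    have mem: "(\<rho> ^^ j) (ys, i) \<in> Y \<times> {..<t}" for j
      using ys by (induction j) (auto simp del: funpow.simps simp: funpow.simps(2) \<rho>_mem)
    have "(F ^^ j) z = \<Phi> ((\<rho> ^^ j) (ys, i))" for j
      by (induction j) (simp_all add: F_def \<Psi>\<Phi>[OF mem] z)
    then show ?thesis
      using ys z by (simp add: \<rho>_pow Y_def)
  qed
  moreover have "F (\<alpha> p, q) = (\<beta> p', q')"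
    if "p \<in> A" "q \<in> Q" "F (p, q) = (p', q')" "p' \<in> B" for p q p' q'
  proof -
    have mem: "p \<in> P" "\<alpha> p \<in> P" "p' \<in> P" "\<beta> p' \<in> P" using that a b by auto
    have "\<Psi> (p, q) \<in> Y \<times> {..<t}" using \<Psi> by (rule bij_betw_apply) (use mem that in auto)
    then obtain ys i where ys: "\<Psi> (p, q) = (ys, i)" "ys \<in> Y" "i < t" by auto
    then obtain p0 zs where zs: "ys = p0 # zs" "zs \<in> Z" by (auto simp: Y_Cons)
    have pq: "(p, q) = \<Phi> (ys, i)" using \<Phi>\<Psi>[of "(p, q)"] mem that ys by simp
    then have p0: "p0 = p" and q: "q = \<eta> (tw p zs, i)" by (auto simp: zs \<Phi>_Cons)
    obtain p1 us where us: "zs = p1 # us" "length us = k - 2" "set us \<subseteq> P" "p1 \<in> P"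
      using zs k by (cases zs) (auto simp: Z_def)
    obtain vs l where vs: "us = vs @ [l]" using us k by (cases us rule: rev_cases) auto
    have lvs: "k - 2 = Suc (length vs)" using us vs by simp
    have "F (p, q) = \<Phi> (zs @ [p], i)"
      by (simp add: F_def ys \<rho>_def zs p0)
    then have "F (p, q) = (p1, \<eta> (tw p1 (us @ [p]), i))"
      by (simp add: us \<Phi>_Cons)
    then have p1: "p1 = p'" and q': "q' = \<eta> (tw p' (us @ [p]), i)" using that by auto
    \<comment> \<open>The unit that \<open>h\<close> loses under \<open>\<alpha>\<close> is made up
      by the extra \<open>\<beta>\<close> in the second factor, while \<open>w\<close> is unchanged;
      hence the label \<open>q\<close> stays fixed.\<close>
    have "tw (\<alpha> p) (\<beta> p' # us) = tw p zs"
      using that by (simp add: tw_def us vs lvs p1 ha wa flip: b'(2))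
        (simp add: funpow_swap1)
    then have "\<Phi> (\<alpha> p # \<beta> p' # us, i) = (\<alpha> p, q)"
      by (simp add: \<Phi>_Cons q)
    moreover have *: "(\<alpha> p # \<beta> p' # us, i) \<in> Y \<times> {..<t}"
      using mem us ys k by (auto simp: Y_def)
    ultimately have "\<Psi> (\<alpha> p, q) = (\<alpha> p # \<beta> p' # us, i)"
      using \<Psi>\<Phi> by metis
    then have "F (\<alpha> p, q) = (\<beta> p', \<eta> (tw (\<beta> p') (us @ [\<alpha> p]), i))"
      by (simp add: F_def \<rho>_def \<Phi>_Cons)
    \<comment> \<open>After the rotation \<open>p\<close> is the last factor: the unit that
      \<open>w\<close> loses under \<open>\<beta>\<close> is made up by \<open>\<alpha>\<close>
      there, while \<open>h\<close> is unchanged.\<close>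
    also have "tw (\<beta> p') (us @ [\<alpha> p]) = tw p' (us @ [p])"
      using that by (cases vs) (simp_all add: tw_def vs lvs hb wb funpow_swap1 nth_append list_update_append flip: a'(2))
    finally show ?thesis by (simp add: q')
  qed
  ultimately show ?thesis using that by blast
qed

text \<open>Where \<open>\<tau>\<close> is not injective it is replaced by an arbitrary injection, which spoils the
  relations at no more than four points for each point in which the two differ.\<close>

lemma transfer_rotation:
  fixes \<tau> :: "'p \<times> 'q \<Rightarrow> 'x" and S T :: "'x \<Rightarrow> 'x" and \<alpha> \<beta> :: "'p \<Rightarrow> 'p"
  assumes fin: "finite X" "finite P" "finite Q"
    and a: "A \<subseteq> P" "inj_on \<alpha> A" "\<alpha> ` A \<subseteq> P"
    and b: "B \<subseteq> P" "inj_on \<beta> B" "\<beta> ` B \<subseteq> P"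
    and \<tau>: "\<tau> ` (P \<times> Q) \<subseteq> X"
    and \<tau>a: "\<And>p q. \<lbrakk>p \<in> A; q \<in> Q\<rbrakk> \<Longrightarrow> \<tau> (\<alpha> p, q) = S (\<tau> (p, q))"
    and \<tau>b: "\<And>p q. \<lbrakk>p \<in> B; q \<in> Q\<rbrakk> \<Longrightarrow> \<tau> (\<beta> p, q) = T (\<tau> (p, q))"
    and F: "bij_betw F (P \<times> Q) (P \<times> Q)" "\<And>z. z \<in> P \<times> Q \<Longrightarrow> (F ^^ k) z = z"
    and Fab: "\<And>p q p' q'. \<lbrakk>p \<in> A; q \<in> Q; F (p, q) = (p', q'); p' \<in> B\<rbrakk> \<Longrightarrow> F (\<alpha> p, q) = (\<beta> p', q')"
    and le: "card (P \<times> Q) \<le> card X"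
  obtains f where "f permutes X" "f ^^ k = id"
    "4 * card (\<tau> ` (P \<times> Q)) \<le> card {x \<in> X. f (S x) = T (f x)} + 3 * card (P \<times> Q)
       + card (P - A) * card Q + card (P - B) * card Q"
proof -
  define Z where "Z = P \<times> Q"
  have finZ: "finite Z" using fin by (simp add: Z_def)
  obtain U where U: "U \<subseteq> Z" "inj_on \<tau> U" "\<tau> ` Z = \<tau> ` U"
    using subset_image_inj[of "\<tau> ` Z" \<tau> Z] by auto
  have finU: "finite U" using U finZ finite_subset by blast
  have cU: "card (\<tau> ` Z) = card U" using U by (simp add: card_image)
  have cZU: "card (Z - U) = card Z - card U" using U finU by (simp add: card_Diff_subset)
  have "card (Z - U) \<le> card (X - \<tau> ` Z)"
    using \<tau> le cU cZU finZ by (simp add: card_Diff_subset Z_def)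
  then obtain \<kappa> where \<kappa>: "\<kappa> ` (Z - U) \<subseteq> X - \<tau> ` Z" "inj_on \<kappa> (Z - U)"
    using card_le_inj[of "Z - U" "X - \<tau> ` Z"] finZ fin by auto
  define \<iota> where "\<iota> z = (if z \<in> U then \<tau> z else \<kappa> z)" for z
  have \<iota>_inj: "inj_on \<iota> Z"
  proof (rule inj_onI)
    fix y z assume yz: "y \<in> Z" "z \<in> Z" "\<iota> y = \<iota> z"
    have ne: "\<tau> u \<noteq> \<kappa> v" if "u \<in> Z" "v \<in> Z - U" for u v using \<kappa>(1) that by blast
    show "y = z"
    proof (cases "y \<in> U"; cases "z \<in> U")
      assume "y \<in> U" "z \<in> U"
      then show ?thesis using yz U(2) by (simp add: \<iota>_def inj_on_eq_iff)
    next
      assume "y \<notin> U" "z \<notin> U"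
      then show ?thesis using yz \<kappa>(2) by (simp add: \<iota>_def inj_on_eq_iff)
    qed (use yz ne ne[symmetric] in \<open>auto simp: \<iota>_def\<close>)
  qed
  have \<iota>_X: "\<iota> ` Z \<subseteq> X" using \<tau> \<kappa> by (auto simp: \<iota>_def Z_def)
  define \<Psi> where "\<Psi> = inv_into Z \<iota>"
  have \<Psi>\<iota>: "\<Psi> (\<iota> z) = z" if "z \<in> Z" for z using \<iota>_inj that by (simp add: \<Psi>_def)
  have F_Z: "F z \<in> Z" if "z \<in> Z" for z using F(1) that by (auto simp: Z_def bij_betw_def)
  have F_inj: "inj_on F Z" using F(1) by (simp add: Z_def bij_betw_def)
  define f where "f x = (if x \<in> \<iota> ` Z then \<iota> (F (\<Psi> x)) else x)" for x
  have f\<iota>: "f (\<iota> z) = \<iota> (F z)" if "z \<in> Z" for z using that by (simp add: f_def \<Psi>\<iota>)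
  have f_inj: "inj_on f (\<iota> ` Z)"
  proof (rule inj_onI)
    fix x y assume xy: "x \<in> \<iota> ` Z" "y \<in> \<iota> ` Z" "f x = f y"
    then obtain u v where uv: "u \<in> Z" "v \<in> Z" "x = \<iota> u" "y = \<iota> v" by blast
    then have "F u = F v" using xy \<iota>_inj F_Z by (simp add: f\<iota> inj_on_eq_iff)
    then show "x = y" using uv F_inj by (simp add: inj_on_eq_iff)
  qed
  have "f ` \<iota> ` Z \<subseteq> \<iota> ` Z" using f\<iota> F_Z by auto
  then have "f ` \<iota> ` Z = \<iota> ` Z" using f_inj finZ by (simp add: endo_inj_surj)
  then have "f permutes (\<iota> ` Z)"
    using f_inj by (intro bij_imp_permutes) (auto simp: bij_betw_def f_def)
  then have "f permutes X" using \<iota>_X by (rule permutes_subset)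
  moreover have "f ^^ k = id"
  proof
    fix x
    show "(f ^^ k) x = id x"
    proof (cases "x \<in> \<iota> ` Z")
      case True
      then obtain z where z: "z \<in> Z" "x = \<iota> z" by auto
      have mem: "(F ^^ j) z \<in> Z" for j by (induction j) (simp_all add: z F_Z)
      have "(f ^^ j) (\<iota> z) = \<iota> ((F ^^ j) z)" for j
        by (induction j) (simp_all add: f\<iota>[OF mem])
      then show ?thesis using F(2) z by (simp add: Z_def)
    next
      case False
      then have "(f ^^ j) x = x" for j by (induction j) (simp_all add: f_def)
      then show ?thesis by simp
    qed
  qed
  moreover have "4 * card (\<tau> ` (P \<times> Q)) \<le> card {x \<in> X. f (S x) = T (f x)} + 3 * card (P \<times> Q)
       + card (P - A) * card Q + card (P - B) * card Q"
  proof -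
    define G where "G = {x \<in> X. f (S x) = T (f x)}"
    define \<alpha>' \<beta>' where "\<alpha>' = (\<lambda>(p, q::'q). (\<alpha> p, q))" and "\<beta>' = (\<lambda>(p, q::'q). (\<beta> p, q))"
    \<comment> \<open>The relation can fail at \<open>z\<close> because one of \<open>z\<close>,
      \<open>\<alpha>' z\<close>, \<open>F z\<close>, \<open>\<beta>' (F z)\<close> is relocated
      (\<open>W\<close>, \<open>B3\<close>, \<open>B4\<close>, \<open>B5\<close>), or because
      \<open>\<alpha>\<close> is undefined at \<open>z\<close> (\<open>B1\<close>) or
      \<open>\<beta>\<close> at \<open>F z\<close> (\<open>B2\<close>). Injectivity bounds each of
      the first four sets by \<open>card W\<close>.\<close>
    define W where "W = Z - U"
    define B1 where "B1 = (P - A) \<times> Q"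
    define B2 where "B2 = {z \<in> Z. F z \<in> (P - B) \<times> Q}"
    define B3 where "B3 = {z \<in> A \<times> Q. \<alpha>' z \<in> W}"
    define B4 where "B4 = {z \<in> Z. F z \<in> W}"
    define B5 where "B5 = {z \<in> Z. F z \<in> B \<times> Q \<and> \<beta>' (F z) \<in> W}"
    have finW: "finite W" using finZ by (simp add: W_def)
    have c2: "card B2 \<le> card ((P - B) \<times> Q)"
      by (rule card_inj_on_le[of F]) (use F_inj fin in \<open>auto simp: B2_def inj_on_def\<close>)
    have c3: "card B3 \<le> card W"
      by (rule card_inj_on_le[of \<alpha>'])
        (use finW a(2) in \<open>auto simp: B3_def \<alpha>'_def inj_on_def\<close>)
    have c4: "card B4 \<le> card W"
      by (rule card_inj_on_le[of F]) (use F_inj finW in \<open>auto simp: B4_def inj_on_def\<close>)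
    have c5: "card B5 \<le> card W"
    proof (rule card_inj_on_le[of "\<beta>' \<circ> F"])
      have "inj_on F B5" using F_inj by (auto simp: B5_def inj_on_def)
      moreover have "inj_on \<beta>' (B \<times> Q)"
        using b(2) by (auto simp: \<beta>'_def inj_on_def)
      then have "inj_on \<beta>' (F ` B5)"
        by (rule inj_on_subset) (unfold B5_def, blast)
      ultimately show "inj_on (\<beta>' \<circ> F) B5" by (rule comp_inj_on)
      show "(\<beta>' \<circ> F) ` B5 \<subseteq> W" unfolding B5_def by auto
    qed (rule finW)
    have "\<iota> z \<in> G" if z: "z \<in> Z" "z \<notin> W \<union> B1 \<union> B2 \<union> B3 \<union> B4 \<union> B5" for z
    proof -
      obtain p q where pq: "z = (p, q)" by force
      obtain p' q' where pq': "F (p, q) = (p', q')" by force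
      have Fz: "(p', q') \<in> Z" using F_Z[OF z(1)] pq pq' by simp
      have mem: "p \<in> A" "q \<in> Q" "p' \<in> B" "q' \<in> Q" "z \<in> U" "F z \<in> U"
        using z Fz by (auto simp: W_def B1_def B2_def B4_def pq pq' Z_def)
      have Z: "(\<alpha> p, q) \<in> Z" "(\<beta> p', q') \<in> Z" using mem a b by (auto simp: Z_def)
      have U': "(\<alpha> p, q) \<in> U" "(\<beta> p', q') \<in> U"
        using z Z mem by (auto simp: W_def B3_def B5_def \<alpha>'_def \<beta>'_def pq pq')
      have "S (\<iota> z) = \<iota> (\<alpha> p, q)"
        using mem U' \<tau>a pq by (simp add: \<iota>_def)
      then have "f (S (\<iota> z)) = \<iota> (\<beta> p', q')"
        using mem Z Fab[of p q p' q'] pq pq' by (simp add: f\<iota>)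
      also have "\<dots> = T (\<iota> (F z))"
        using mem U' \<tau>b pq pq' by (simp add: \<iota>_def)
      also have "\<dots> = T (f (\<iota> z))" using z by (simp add: f\<iota>)
      finally show ?thesis using \<iota>_X z by (auto simp: G_def)
    qed
    then have "\<iota> ` (Z - (W \<union> B1 \<union> B2 \<union> B3 \<union> B4 \<union> B5)) \<subseteq> G" by blast
    then have "card (Z - (W \<union> B1 \<union> B2 \<union> B3 \<union> B4 \<union> B5)) \<le> card G"
      using inj_on_subset[OF \<iota>_inj Diff_subset] fin(1)
      by (intro card_inj_on_le[of \<iota>]) (auto simp: G_def)
    moreover have "card Z - card (W \<union> B1 \<union> B2 \<union> B3 \<union> B4 \<union> B5)
        \<le> card (Z - (W \<union> B1 \<union> B2 \<union> B3 \<union> B4 \<union> B5))"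
      using finZ fin finW finite_subset[OF a(1)]
      by (intro diff_card_le_card_Diff) (simp add: B1_def B2_def B3_def B4_def B5_def)
    moreover have "card (W \<union> B1 \<union> B2 \<union> B3 \<union> B4 \<union> B5)
        \<le> card W + card B1 + card B2 + card B3 + card B4 + card B5"
      using card_Un_le[of "W \<union> B1 \<union> B2 \<union> B3 \<union> B4" B5] card_Un_le[of "W \<union> B1 \<union> B2 \<union> B3" B4]
        card_Un_le[of "W \<union> B1 \<union> B2" B3] card_Un_le[of "W \<union> B1" B2] card_Un_le[of W B1]
      by linarith
    ultimately have "card Z \<le> card G + 4 * card W + card B1 + card ((P - B) \<times> Q)"
      using c2 c3 c4 c5 by linarith
    moreover have "card W = card Z - card U" "card U \<le> card Z"
      using cZU U finZ by (simp_all add: W_def card_mono)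
    ultimately show ?thesis
      using cU by (simp add: G_def B1_def card_cartesian_product flip: Z_def)
  qed
  ultimately show ?thesis using that by blast
qed

section \<open>Covering the cyclic group by tiles\<close>

text \<open>The base of the tower. The cut-off \<open>R\<close> makes membership depend only on the
  marks along the first \<open>R\<close> steps, hence on finitely many digits.\<close>

definition hits_at_multiple :: "('x \<Rightarrow> 'x) \<Rightarrow> ('x \<Rightarrow> bool) \<Rightarrow> nat \<Rightarrow> nat \<Rightarrow> 'x \<Rightarrow> bool" where
  "hits_at_multiple T K L R x \<longleftrightarrow> (\<exists>r<R. L dvd r \<and> K ((T ^^ r) x) \<and> (\<forall>i<r. \<not> K ((T ^^ i) x)))"

text \<open>If the first mark comes at time \<open>r\<close>, moving forward by
  \<open>r mod L\<close> steps leaves a waiting time divisible by \<open>L\<close>.\<close>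

lemma hits_at_multiple_covers:
  assumes "L > 0" "i < R" "K ((T ^^ i) y)"
  obtains j where "j < L" "hits_at_multiple T K L R ((T ^^ j) y)"
proof -
  define r where "r = (LEAST i. K ((T ^^ i) y))"
  have r: "K ((T ^^ r) y)" "r < R" and min: "\<And>i. i < r \<Longrightarrow> \<not> K ((T ^^ i) y)"
    using assms LeastI[of "\<lambda>i. K ((T ^^ i) y)" i] Least_le[of "\<lambda>i. K ((T ^^ i) y)" i] not_less_Least
    unfolding r_def by fastforce+
  define j where "j = r mod L"
  have T: "(T ^^ i) ((T ^^ j) y) = (T ^^ (i + j)) y" for i by (simp add: funpow_add)
  have "hits_at_multiple T K L R ((T ^^ j) y)"
    unfolding hits_at_multiple_def T
  proof (intro exI[of _ "r - j"] conjI allI impI)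
    show "K ((T ^^ (r - j + j)) y)" using r by (simp add: j_def)
    show "L dvd r - j" by (simp add: j_def minus_mod_eq_mult_div)
    show "r - j < R" using r by simp
    show "\<not> K ((T ^^ (i + j)) y)" if "i < r - j" for i using min that by simp
  qed
  then show ?thesis using that[of j] assms(1) by (simp add: j_def)
qed

text \<open>Without a mark in the first \<open>L\<close> steps, all points \<open>(T ^^ i) y\<close>
  with \<open>i < L\<close> wait for the same mark; lying in the base fixes \<open>i\<close> modulo
  \<open>L\<close>.\<close>

lemma hits_at_multiple_unique:
  assumes hit: "hits_at_multiple T K L R ((T ^^ i) y)" "hits_at_multiple T K L R ((T ^^ j) y)"
    and no: "\<And>l. l < L \<Longrightarrow> \<not> K ((T ^^ l) y)" and ij: "i < L" "j < L"
  shows "i = j"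
proof -
  have T: "(T ^^ a) ((T ^^ b) y) = (T ^^ (a + b)) y" for a b by (simp add: funpow_add)
  obtain r where r: "L dvd r" "K ((T ^^ (r + i)) y)" "\<forall>a<r. \<not> K ((T ^^ (a + i)) y)"
    using hit(1) unfolding hits_at_multiple_def T by blast
  obtain s where s: "L dvd s" "K ((T ^^ (s + j)) y)" "\<forall>a<s. \<not> K ((T ^^ (a + j)) y)"
    using hit(2) unfolding hits_at_multiple_def T by blast
  have first: "\<not> K ((T ^^ b) y)" if "b < r + i \<or> b < s + j" for b
  proof (cases "b < L")
    case False
    then have b: "b = (b - i) + i" "b = (b - j) + j" using ij by auto
    from that show ?thesis
    proof
      assume "b < r + i"
      then have "b - i < r" using b by linarith
      with r(3) b(1) show ?thesis by metis
    next
      assume "b < s + j"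
      then have "b - j < s" using b by linarith
      with s(3) b(2) show ?thesis by metis
    qed
  qed (use no in simp)
  have "r + i = s + j"
    using first r(2) s(2) by (metis nat_neq_iff)
  then have "(r + i) mod L = (s + j) mod L" by simp
  then show ?thesis using r(1) s(1) ij by (auto elim!: dvdE)
qed

text \<open>Double counting of the pairs \<open>(y, j)\<close> with \<open>j < L\<close> and
  \<open>(T ^^ j) y\<close> in the base: \<open>y\<close> has at most one such \<open>j\<close>
  unless its first \<open>L\<close> steps meet a mark, and then its at most \<open>L\<close> pairs
  are charged to marks.\<close>

lemma card_hits_at_multiple_le:
  assumes fin: "finite X" and T: "bij_betw T X X"
  shows "L * card {x \<in> X. hits_at_multiple T K L R x} \<le> card X + L * L * card {x \<in> X. K x}"
proof -
  have pull: "card {y \<in> X. p ((T ^^ j) y)} = card {x \<in> X. p x}" for j and p :: "'a \<Rightarrow> bool"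
  proof -
    have bij: "bij_betw (T ^^ j) X X" using T by (rule bij_betw_funpow)
    have "(T ^^ j) ` {y \<in> X. p ((T ^^ j) y)} = {x \<in> X. p x}"
      using bij by (auto simp: bij_betw_def)
    then show ?thesis
      using bij by (metis (no_types, lifting) bij_betw_def card_image inj_on_subset mem_Collect_eq subsetI)
  qed
  let ?H = "hits_at_multiple T K L R"
  have "L * card {x \<in> X. ?H x} = (\<Sum>j\<in>{..<L}. card {y \<in> X. ?H ((T ^^ j) y)})"
    by (simp add: pull)
  also have "\<dots> = (\<Sum>y\<in>X. card {j \<in> {..<L}. ?H ((T ^^ j) y)})"
    using fin by (intro sum_multicount_gen) auto
  also have "\<dots> \<le> (\<Sum>y\<in>X. 1 + L * card {l \<in> {..<L}. K ((T ^^ l) y)})"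
  proof (rule sum_mono)
    fix y assume "y \<in> X"
    show "card {j \<in> {..<L}. ?H ((T ^^ j) y)} \<le> 1 + L * card {l \<in> {..<L}. K ((T ^^ l) y)}"
    proof (cases "\<forall>l<L. \<not> K ((T ^^ l) y)")
      case True
      then have "card {j \<in> {..<L}. ?H ((T ^^ j) y)} \<le> 1"
        using hits_at_multiple_unique[of T K L R _ y] by (auto simp: card_le_Suc0_iff_eq)
      then show ?thesis by simp
    next
      case False
      then have "{l \<in> {..<L}. K ((T ^^ l) y)} \<noteq> {}" by auto
      then have "1 \<le> card {l \<in> {..<L}. K ((T ^^ l) y)}" by (simp add: Suc_le_eq card_gt_0_iff)
      then have "L * 1 \<le> L * card {l \<in> {..<L}. K ((T ^^ l) y)}" by (rule mult_le_mono2)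
      moreover have "card {j \<in> {..<L}. ?H ((T ^^ j) y)} \<le> card {..<L}" by (intro card_mono) auto
      ultimately show ?thesis by (simp only: card_lessThan)
    qed
  qed
  also have "\<dots> = card X + L * (\<Sum>y\<in>X. card {l \<in> {..<L}. K ((T ^^ l) y)})"
    by (simp only: sum.distrib sum_distrib_left) simp
  also have "(\<Sum>y\<in>X. card {l \<in> {..<L}. K ((T ^^ l) y)}) = (\<Sum>l\<in>{..<L}. card {y \<in> X. K ((T ^^ l) y)})"
    using fin by (intro sum_multicount_gen) auto
  finally show ?thesis by (simp add: pull)
qed

section \<open>Leading digits of residues and counting\<close>

lemma int_div_bounds:
  fixes a b :: int
  assumes "b > 0"
  shows "b * (a div b) \<le> a" "a < b * (a div b) + b"
  using assms mult_div_mod_eq[of b a] pos_mod_bound[of b a] pos_mod_sign[of b a] by linarith+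

lemma int_div_less_iff:
  fixes a b c :: int
  assumes "b > 0"
  shows "a div b < c \<longleftrightarrow> a < c * b"
proof
  assume "a div b < c"
  then have "b * (a div b + 1) \<le> b * c" using assms by (intro mult_left_mono) auto
  then show "a < c * b" using int_div_bounds(2)[OF assms, of a] by (simp add: algebra_simps)
next
  assume "a < c * b"
  then have "b * (a div b) < b * c" using int_div_bounds(1)[OF assms, of a] by (simp add: mult.commute)
  then show "a div b < c" using assms by simp
qed

text \<open>The left side is the first base-\<open>m\<close> digit of the fractional part of
  \<open>a / n\<close>; the integral part only contributes multiples of \<open>m\<close>.\<close>

lemma digit_of_residue:
  fixes m n a :: int
  assumes "m > 0" "n > 0"
  shows "(m * (a mod n)) div n = (m * a div n) mod m"
proof -
  have "m * a = m * (a mod n) + (m * (a div n)) * n"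
    by (metis distrib_left mod_mult_div_eq mult.assoc mult.commute)
  then have "m * a div n = m * (a div n) + m * (a mod n) div n"
    using assms by (simp add: add.commute)
  moreover have "0 \<le> m * (a mod n) div n" "m * (a mod n) div n < m"
    using assms by (simp_all add: pos_imp_zdiv_nonneg_iff int_div_less_iff) 
  ultimately show ?thesis by (simp add: mod_pos_pos_trivial)
qed

lemma funpow_mult_mod:
  fixes m n x :: int
  assumes "x mod n = x"
  shows "((\<lambda>x. m * x mod n) ^^ i) x = m ^ i * x mod n"
  using assms by (induction i) (simp_all add: mod_mult_right_eq mult.assoc)

text \<open>Multiplication by \<open>m\<close> shifts the expansion of \<open>x / n\<close>. The
  number \<open>m ^ R * x div n\<close> collects its first \<open>R\<close> digits with the leading
  one on top, hence the reversed exponent \<open>R - 1 - i\<close>.\<close>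

lemma digit_of_orbit:
  fixes m n x :: int
  assumes "m > 0" "n > 0" "x mod n = x" "i < R"
  shows "m * ((\<lambda>x. m * x mod n) ^^ i) x div n = (m ^ R * x div n) div m ^ (R - 1 - i) mod m"
proof -
  have R: "m ^ R = m ^ (R - 1 - i) * m ^ Suc i"
    using assms(4) by (simp flip: power_add power_Suc)
  have "(m ^ R * x div n) div m ^ (R - 1 - i) = m ^ R * x div (n * m ^ (R - 1 - i))"
    using assms by (simp add: zdiv_zmult2_eq)
  also have "\<dots> = m ^ Suc i * x div n"
    using assms by (simp only: R mult.commute[of n] mult.assoc) (simp add: div_mult_mult1)
  finally show ?thesis
    using assms by (simp add: funpow_mult_mod digit_of_residue mult.assoc)
qed

lemma card_scaled_fibre_le:
  fixes c n w :: int
  assumes "c > 0" "n > 0"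
  shows "finite {x. c * x div n = w}" "card {x. c * x div n = w} \<le> nat (n div c + 1)"
proof -
  \<comment> \<open>The ceiling of \<open>w * n / c\<close>, the left end of the fibre.\<close>
  define a where "a = - ((- w * n) div c)"
  have ca: "w * n \<le> c * a" "c * a < w * n + c"
    using int_div_bounds[OF assms(1), of "- w * n"] by (simp_all add: a_def)
  have "{x. c * x div n = w} \<subseteq> {a..a + n div c}"
  proof
    fix x assume "x \<in> {x. c * x div n = w}"
    then have x: "w * n \<le> c * x" "c * x < w * n + n"
      using int_div_bounds[OF assms(2), of "c * x"] by (auto simp: mult.commute)
    have "c * a < c * (x + 1)" using ca x by (simp add: distrib_left)
    then have "a \<le> x" using assms by simp
    have "(x - a) * c \<le> n" using x ca by (simp add: algebra_simps)
    then have "x - a \<le> n div c" using assms int_div_less_iff[of c n "x - a"] by linarith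
    then show "x \<in> {a..a + n div c}" using \<open>a \<le> x\<close> by simp
  qed
  then show "finite {x. c * x div n = w}" "card {x. c * x div n = w} \<le> nat (n div c + 1)"
    using card_mono[of "{a..a + n div c}"] finite_subset[of _ "{a..a + n div c}"] by auto
qed

text \<open>Induction by stripping the lowest digit, which has \<open>m - g\<close> possible
  values.\<close>

lemma card_large_digits_le:
  fixes m g :: int
  assumes "0 \<le> g" "g \<le> m" "m > 0"
  shows "card {w \<in> {0..<m ^ R}. \<forall>i<R. g \<le> w div m ^ i mod m} \<le> nat (m - g) ^ R"
proof (induction R)
  case (Suc R)
  let ?W = "\<lambda>R. {w \<in> {0..<m ^ R}. \<forall>i<R. g \<le> w div m ^ i mod m}"
  have "?W (Suc R) \<subseteq> (\<lambda>(u, d). m * u + d) ` (?W R \<times> {g..<m})"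
  proof
    fix w assume w: "w \<in> ?W (Suc R)"
    have "w div m div m ^ i = w div m ^ Suc i" for i
      using assms by (simp add: zdiv_zmult2_eq mult.commute)
    moreover have "0 \<le> w div m" "w div m < m ^ R"
      using w assms by (auto simp: pos_imp_zdiv_nonneg_iff int_div_less_iff mult.commute)
    ultimately have "w div m \<in> ?W R" using w by auto
    moreover have "w mod m \<in> {g..<m}" using w assms by auto
    ultimately show "w \<in> (\<lambda>(u, d). m * u + d) ` (?W R \<times> {g..<m})"
      by (intro image_eqI[of _ _ "(w div m, w mod m)"]) auto
  qed
  moreover have "finite (?W R \<times> {g..<m})"
    by (intro finite_cartesian_product finite_subset[of "?W R" "{0..<m ^ R}"]) auto
  ultimately have "card (?W (Suc R)) \<le> card (?W R \<times> {g..<m})"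
    by (rule surj_card_le[rotated])
  also have "\<dots> = card (?W R) * nat (m - g)" by (simp add: card_cartesian_product)
  also have "\<dots> \<le> nat (m - g) ^ R * nat (m - g)" using Suc by (rule mult_le_mono1)
  finally show ?case by (simp add: mult.commute)
next
  case 0
  have "{w. 0 \<le> w \<and> w < (1::int)} = {0}" by auto
  then show ?case by simp
qed

lemma card_UN_le_mult:
  assumes "finite W" "\<And>w. w \<in> W \<Longrightarrow> card (A w) \<le> b"
  shows "card (\<Union>w\<in>W. A w) \<le> card W * b"
  using card_UN_le[OF assms(1), of A] sum_bounded_above[of W "\<lambda>w. card (A w)" b] assms(2)
  by fastforce

lemma card_small_leading_digit_le:
  fixes m n g :: int
  assumes "m > 0" "n > 0" "g \<ge> 0"
  shows "card {x \<in> {0..<n}. m * x div n < g} \<le> nat g * nat (n div m + 1)"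
proof -
  have "card {x \<in> {0..<n}. m * x div n < g} \<le> card (\<Union>w\<in>{0..<g}. {x. m * x div n = w})"
    using assms card_scaled_fibre_le(1)[of m n]
    by (intro card_mono) (auto simp: pos_imp_zdiv_nonneg_iff)
  also have "\<dots> \<le> card {0..<g} * nat (n div m + 1)"
    using assms by (intro card_UN_le_mult card_scaled_fibre_le) auto
  finally show ?thesis by simp
qed

text \<open>Meeting no mark for \<open>R\<close> steps means that all \<open>R\<close> leading
  digits are at least \<open>g\<close>, so at most \<open>(m - g) ^ R\<close> fibres of
  \<open>m ^ R * x div n\<close> are involved.\<close>

lemma card_never_hit_le:
  fixes m n g :: int
  assumes mn: "m > 0" "n > 0" and g: "0 \<le> g" "g \<le> m"
  shows "card {x \<in> {0..<n}. \<forall>i<R. \<not> m * ((\<lambda>x. m * x mod n) ^^ i) x div n < g}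
    \<le> nat (m - g) ^ R * nat (n div m ^ R + 1)" (is "card ?V \<le> _")
proof -
  define W where "W = {w \<in> {0..<m ^ R}. \<forall>i<R. g \<le> w div m ^ i mod m}"
  have finW: "finite W" unfolding W_def by (rule finite_subset[of _ "{0..<m ^ R}"]) auto
  have "?V \<subseteq> (\<Union>w\<in>W. {x. m ^ R * x div n = w})"
  proof
    fix x assume x: "x \<in> ?V"
    have "g \<le> (m ^ R * x div n) div m ^ i mod m" if "i < R" for i
    proof -
      have "R - 1 - i < R" "R - 1 - (R - 1 - i) = i" using that by simp_all
      then show ?thesis
        using x digit_of_orbit[of m n x "R - 1 - i" R] mn by (metis (no_types, lifting)
            atLeastLessThan_iff mem_Collect_eq mod_pos_pos_trivial not_less)
    qed
    moreover have "0 \<le> m ^ R * x div n" "m ^ R * x div n < m ^ R"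
      using x mn by (auto simp: pos_imp_zdiv_nonneg_iff int_div_less_iff)
    ultimately show "x \<in> (\<Union>w\<in>W. {x. m ^ R * x div n = w})" by (simp add: W_def)
  qed
  then have "card ?V \<le> card (\<Union>w\<in>W. {x. m ^ R * x div n = w})"
    using mn finW by (intro card_mono finite_UN_I card_scaled_fibre_le(1)) auto
  also have "\<dots> \<le> card W * nat (n div m ^ R + 1)"
    using mn finW by (intro card_UN_le_mult card_scaled_fibre_le(2)) auto
  also have "\<dots> \<le> nat (m - g) ^ R * nat (n div m ^ R + 1)"
    unfolding W_def using assms by (intro mult_le_mono1 card_large_digits_le) auto
  finally show ?thesis .
qed

text \<open>The cell of length \<open>M\<close> around such an \<open>x\<close> reaches
  \<open>n\<close> or is cut by a breakpoint \<open>w * n / c\<close> with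
  \<open>0 \<le> w \<le> c\<close>, so \<open>x\<close> is within about \<open>M\<close> of one of
  \<open>c + 1\<close> breakpoints.\<close>

lemma card_split_cells_le:
  fixes c n M :: int
  assumes c: "c > 0" and n: "n > 0" and M: "M > 0"
  shows "card {x \<in> {0..<n}. \<exists>y. y div M = x div M \<and> (n \<le> y \<or> c * y div n \<noteq> c * x div n)}
    \<le> nat (c + 1) * nat (2 * M + 1)" (is "card ?B \<le> _")
proof -
  have "?B \<subseteq> (\<Union>w\<in>{0..c}. {w * n div c - M..w * n div c + M})"
  proof
    fix x assume "x \<in> ?B"
    then obtain y where x: "0 \<le> x" "x < n" and y: "y div M = x div M"
      and ne: "n \<le> y \<or> c * y div n \<noteq> c * x div n" by auto
    have "x \<le> y + M" "y \<le> x + M"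
      using y int_div_bounds[OF M, of x] int_div_bounds[OF M, of y] by simp_all
    then have near: "c * x \<le> c * y + c * M" "c * y \<le> c * x + c * M"
      using c by (simp_all flip: distrib_left)
    have y0: "0 \<le> y" using x y M by (metis pos_imp_zdiv_nonneg_iff)
    have cx: "0 \<le> c * x div n" "c * x div n < c"
      using x c n by (auto simp: pos_imp_zdiv_nonneg_iff int_div_less_iff)
    have cy: "0 \<le> c * y div n" using y0 c n by (auto simp: pos_imp_zdiv_nonneg_iff)
    have bx: "c * x div n * n \<le> c * x" "c * x < (c * x div n + 1) * n"
      using int_div_bounds[OF n, of "c * x"] by (simp_all add: algebra_simps)
    \<comment> \<open>The breakpoint that separates \<open>x\<close> from \<open>y\<close>: the next
      one above \<open>x\<close> if \<open>y\<close> lies in a later fibre or beyond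
      \<open>n\<close>, otherwise the last one not above \<open>x\<close>.\<close>
    have "\<exists>w\<in>{0..c}. w * n \<le> c * x + c * M \<and> c * x \<le> w * n + c * M"
    proof (cases "c * x div n < c * y div n \<or> n \<le> y")
      case True
      have "(c * x div n + 1) * n \<le> c * y"
      proof (cases "n \<le> y")
        case True
        have "(c * x div n + 1) * n \<le> c * n" using cx n by (intro mult_right_mono) auto
        also have "\<dots> \<le> c * y" using True c by simp
        finally show ?thesis .
      next
        case False
        then have "c * x div n + 1 \<le> c * y div n" using True by simp
        then have "(c * x div n + 1) * n \<le> c * y div n * n" using n by (intro mult_right_mono) auto
        also have "\<dots> \<le> c * y"
          using int_div_bounds[OF n, of "c * y"] by (simp add: mult.commute)
        finally show ?thesis .
      qed
      then show ?thesis
        using cx near bx c M by (intro bexI[of _ "c * x div n + 1"]) (auto intro: order_trans)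
    next
      case False
      then have "c * y div n + 1 \<le> c * x div n" using ne by simp
      then have "(c * y div n + 1) * n \<le> c * x div n * n" using n by (intro mult_right_mono) auto
      moreover have "c * y < (c * y div n + 1) * n"
        using int_div_bounds[OF n, of "c * y"] by (simp add: algebra_simps)
      ultimately have "c * y < c * x div n * n" by linarith
      moreover have "0 \<le> c * M" using c M by simp
      ultimately show ?thesis
        using cx near bx by (intro bexI[of _ "c * x div n"]) auto
    qed
    then obtain w where w: "w \<in> {0..c}" "w * n \<le> c * x + c * M" "c * x \<le> w * n + c * M" by blast
    have q: "c * (w * n div c) \<le> w * n" "w * n < c * (w * n div c) + c"
      using int_div_bounds[OF c, of "w * n"] by simp_all
    have "c * (w * n div c) \<le> c * (x + M)" "c * x < c * (w * n div c + M + 1)"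
      using w q by (simp_all add: distrib_left)
    then have "w * n div c \<le> x + M" "x < w * n div c + M + 1"
      using c by simp_all
    then show "x \<in> (\<Union>w\<in>{0..c}. {w * n div c - M..w * n div c + M})"
      using w(1) by (intro UN_I[of w]) auto
  qed
  then have "card ?B \<le> card (\<Union>w\<in>{0..c}. {w * n div c - M..w * n div c + M})"
    by (intro card_mono) auto
  also have "\<dots> \<le> card {0..c} * nat (2 * M + 1)"
    by (intro card_UN_le_mult) auto
  finally show ?thesis by simp
qed

section \<open>Tiles and the covering\<close>

lemma exists_digits:
  fixes s m :: nat
  assumes "s < m ^ L"
  obtains c where "c \<in> {..<L} \<rightarrow>\<^sub>E {..<m}" "s = (\<Sum>i<L. c i * m ^ i)"
proof -
  have m: "m > 0" if "L > 0" using assms that by (cases m) (auto simp: power_0_left)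
  have "(\<Sum>i<L. s div m ^ i mod m * m ^ i) = s mod m ^ L" for L
  proof (induction L)
    case (Suc L)
    have "s mod m ^ Suc L = m ^ L * (s div m ^ L mod m) + s mod m ^ L"
      unfolding power_Suc2 by (rule mod_mult2_eq)
    with Suc show ?case by simp
  qed simp
  then have "s = (\<Sum>i<L. (\<lambda>i\<in>{..<L}. s div m ^ i mod m) i * m ^ i)"
    using assms by simp
  then show ?thesis
    using that[of "\<lambda>i\<in>{..<L}. s div m ^ i mod m"] m by auto
qed

text \<open>Digit strings are extensional functions, so that there are exactly \<open>m ^ L\<close>
  of them.\<close>

definition tile :: "nat \<Rightarrow> nat \<Rightarrow> ((nat \<Rightarrow> nat) \<times> nat) set" where
  "tile m L = ({..<L} \<rightarrow>\<^sub>E {..<m}) \<times> {..<L}"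

text \<open>The tile over the cell \<open>[q m\<^sup>L, (q + 1) m\<^sup>L)\<close> consists of the preimages of the cell under
  multiplication by \<open>m\<^sup>j\<close>, \<open>j < L\<close>; here \<open>v\<close> is the inverse of \<open>m\<close>. Positions are counted
  from the right end of the cell, so that adding \<open>1\<close> at level \<open>j\<close> lowers the \<open>j\<close>-th digit.\<close>

definition tile_point :: "nat \<Rightarrow> nat \<Rightarrow> int \<Rightarrow> int \<Rightarrow> ((nat \<Rightarrow> nat) \<times> nat) \<times> int \<Rightarrow> int" where
  "tile_point m L n v = (\<lambda>((c, j), q).
     v ^ j * (q * int m ^ L + int m ^ L - 1 - int (\<Sum>i<L. c i * m ^ i)) mod n)"

lemma card_tile: "finite (tile m L)" "card (tile m L) = m ^ L * L"
  by (simp_all add: tile_def card_cartesian_product card_funcsetE finite_PiE)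

text \<open>The first bound says that the tiles hardly overlap, the excess coming from marks. The
  second loses the points that meet no mark within \<open>R\<close> steps and those that reach a
  split cell within fewer than \<open>L\<close> steps.\<close>

lemma tile_covering_exists:
  fixes n v :: int and m L R g :: nat
  assumes m: "m > 0" and L: "L > 0" and n: "n > 0" and g: "g \<le> m"
    and v: "[v * int m = 1] (mod n)"
  obtains Q where "finite Q"
    "card (tile m L) * card Q \<le> nat n + L * L * (g * nat (n div int m + 1))"
    "nat n \<le> card (tile_point m L n v ` (tile m L \<times> Q))
       + (m - g) ^ R * nat (n div int m ^ R + 1) + L * ((m ^ R + 1) * (2 * m ^ L + 1))"
proof -
  define X where "X = {0..<n}"
  define M where "M = int m ^ L"
  define T where "T = (\<lambda>x. int m * x mod n)"
  define K where "K x \<longleftrightarrow> int m * x div n < int g" for x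
  define E where "E = {x \<in> X. hits_at_multiple T K L R x}"
  \<comment> \<open>Only cells lying entirely in the base carry tiles.\<close>
  define Q where "Q = {q. {q * M..<q * M + M} \<subseteq> E}"
  define C where "C = int m ^ R"
  define B where "B = {x \<in> {0..<n}. \<exists>y. y div M = x div M \<and> (n \<le> y \<or> C * y div n \<noteq> C * x div n)}"
  define V where "V = {x \<in> X. \<forall>i<R. \<not> K ((T ^^ i) x)}"
  let ?\<tau> = "tile_point m L n v"
  have finX: "finite X" by (simp add: X_def)
  have M: "M > 0" and C: "C > 0" using m by (simp_all add: M_def C_def)
  have T_X: "T x \<in> X" for x using n by (simp add: T_def X_def)
  have T_pow: "(T ^^ i) x \<in> X" if "x \<in> X" for i x using that T_X by (cases i) auto
  have T_pow_eq: "(T ^^ i) x = int m ^ i * x mod n" if "x \<in> X" for i x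
    using funpow_mult_mod[where m = "int m"] that by (simp add: T_def X_def)
  have v_pow: "v ^ j * (int m ^ j * x) mod n = x" if "x \<in> X" for j x
  proof -
    have "[(v * int m) ^ j * x = 1 ^ j * x] (mod n)" by (intro cong_mult cong_pow v cong_refl)
    then show ?thesis using that by (simp add: X_def cong_def power_mult_distrib mult.assoc)
  qed
  have T_inj: "inj_on (T ^^ j) X" for j
  proof (rule inj_onI)
    fix x y assume xy: "x \<in> X" "y \<in> X" "(T ^^ j) x = (T ^^ j) y"
    then have "v ^ j * (int m ^ j * x mod n) mod n = v ^ j * (int m ^ j * y mod n) mod n"
      by (simp add: T_pow_eq)
    then show "x = y" using xy v_pow by (simp add: mod_mult_right_eq)
  qed
  have "bij_betw T X X"
    using T_inj[of 1] T_X finX by (simp add: bij_betw_def endo_inj_surj image_subset_iff)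
  then have "L * card E \<le> card X + L * L * card {x \<in> X. K x}"
    unfolding E_def by (rule card_hits_at_multiple_le[OF finX])
  also have "card {x \<in> X. K x} \<le> g * nat (n div int m + 1)"
    using card_small_leading_digit_le[of "int m" n "int g"] m n by (simp add: X_def K_def)
  finally have card_E: "L * card E \<le> nat n + L * L * (g * nat (n div int m + 1))"
    by (simp add: X_def)
  have Q_img: "(\<lambda>(q, s). q * M + s) ` (Q \<times> {0..<M}) \<subseteq> E" by (fastforce simp: Q_def)
  have Q_inj: "inj_on (\<lambda>(q, s). q * M + s) (Q \<times> {0..<M})"
  proof (rule inj_onI, clarsimp)
    fix q s q' s' assume s: "0 \<le> s" "s < M" "0 \<le> s'" "s' < M" and eq: "q * M + s = q' * M + s'"
    have "(q * M + s) div M = q" "(q' * M + s') div M = q'"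
      using s M by (simp_all add: div_pos_pos_trivial)
    then show "q = q' \<and> s = s'" using eq by simp
  qed
  have finE: "finite E" using finX by (simp add: E_def)
  have "Q \<subseteq> (\<lambda>x. x div M) ` E"
  proof
    fix q assume "q \<in> Q"
    then have "q * M \<in> E" using M by (auto simp: Q_def)
    then show "q \<in> (\<lambda>x. x div M) ` E" using M by (intro image_eqI[of _ _ "q * M"]) auto
  qed
  then have finQ: "finite Q" using finE finite_surj by blast
  have "card (Q \<times> {0..<M}) \<le> card E" using Q_inj Q_img finE by (rule card_inj_on_le)
  then have "card Q * m ^ L \<le> card E"
    by (simp add: card_cartesian_product M_def nat_power_eq)
  then have "card (tile m L) * card Q \<le> L * card E"
    by (simp add: card_tile mult.commute mult.left_commute)
  with card_E have bound1: "card (tile m L) * card Q \<le> nat n + L * L * (g * nat (n div int m + 1))"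
    by linarith
  \<comment> \<open>The marks met in the first \<open>R\<close> steps can be read off from
    \<open>m ^ R * x div n\<close>, so \<open>E\<close> is a union of fibres of this map on
    \<open>X\<close>.\<close>
  have same_E: "y \<in> E" if "x \<in> E" "y \<in> X" "C * y div n = C * x div n" for x y
  proof -
    have "K ((T ^^ i) y) \<longleftrightarrow> K ((T ^^ i) x)" if "i < R" for i
      using digit_of_orbit[of "int m" n x i R] digit_of_orbit[of "int m" n y i R] m n that
        \<open>x \<in> E\<close> \<open>y \<in> X\<close> \<open>C * y div n = C * x div n\<close>
      by (simp add: K_def T_def E_def X_def C_def)
    then show ?thesis
      using that(1,2) unfolding E_def hits_at_multiple_def by (auto dest: order.strict_trans)
  qed
  have cell: "x div M \<in> Q" if "x \<in> E" "x \<notin> B" for x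
  proof -
    have "y \<in> E" if y: "y \<in> {x div M * M..<x div M * M + M}" for y
    proof (rule same_E[OF \<open>x \<in> E\<close>])
      have "y < (x div M + 1) * M" "\<not> y < x div M * M" using y by (simp_all add: distrib_right)
      then have eq: "y div M = x div M"
        using int_div_less_iff[OF M, of y "x div M + 1"] int_div_less_iff[OF M, of y "x div M"] by linarith
      have x: "0 \<le> x" "x < n" using \<open>x \<in> E\<close> by (auto simp: E_def X_def)
      then have nB: "\<not> (n \<le> y \<or> C * y div n \<noteq> C * x div n)"
        using \<open>x \<notin> B\<close> eq unfolding B_def mem_Collect_eq atLeastLessThan_iff by blast
      then show "C * y div n = C * x div n" by simp
      have "0 \<le> x div M * M" using x M by (simp add: pos_imp_zdiv_nonneg_iff)
      then have "0 \<le> y" using y by simp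
      then show "y \<in> X" using nB by (simp add: X_def)
    qed
    then show ?thesis unfolding Q_def by blast
  qed
  have covered: "y \<in> ?\<tau> ` (tile m L \<times> Q)" if y: "y \<in> X" "j < L" "(T ^^ j) y \<in> E" "(T ^^ j) y \<notin> B" for y j
  proof -
    define e where "e = (T ^^ j) y"
    define q where "q = e div M"
    define s where "s = nat (q * M + M - 1 - e)"
    have "0 \<le> q * M + M - 1 - e" "q * M + M - 1 - e < M"
      using int_div_bounds[OF M, of e] by (auto simp: q_def mult.commute)
    then have s: "int s = q * M + M - 1 - e" "s < m ^ L"
      by (auto simp: s_def M_def zless_nat_conj nat_less_iff)
    obtain c where c: "c \<in> {..<L} \<rightarrow>\<^sub>E {..<m}" "s = (\<Sum>i<L. c i * m ^ i)"
      using exists_digits[OF s(2)] .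
    have "?\<tau> ((c, j), q) = v ^ j * e mod n"
      unfolding tile_point_def using s(1) c(2) by (simp add: M_def)
    also have "\<dots> = y"
      using v_pow[OF y(1), of j] by (simp add: e_def T_pow_eq[OF y(1)] mod_mult_right_eq)
    finally have "y = ?\<tau> ((c, j), q)" by simp
    moreover have "q \<in> Q" using cell y by (simp add: q_def e_def)
    ultimately show ?thesis using c(1) y(2) by (auto simp: tile_def)
  qed
  have "B \<subseteq> X" unfolding B_def X_def by blast
  then have finB: "finite B" using finX finite_subset by blast
  have "X \<subseteq> ?\<tau> ` (tile m L \<times> Q) \<union> V \<union> (\<Union>j\<in>{..<L}. {y \<in> X. (T ^^ j) y \<in> B})"
  proof
    fix y assume y: "y \<in> X"
    show "y \<in> ?\<tau> ` (tile m L \<times> Q) \<union> V \<union> (\<Union>j\<in>{..<L}. {y \<in> X. (T ^^ j) y \<in> B})"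
    proof (cases "y \<in> V")
      case False
      then obtain i where "i < R" "K ((T ^^ i) y)" using y unfolding V_def by blast
      then obtain j where j: "j < L" "hits_at_multiple T K L R ((T ^^ j) y)"
        by (rule hits_at_multiple_covers[OF L])
      then have "(T ^^ j) y \<in> E" using T_pow[OF y] by (simp add: E_def)
      then show ?thesis using covered[OF y j(1)] y j(1) by blast
    qed simp
  qed
  then have "card X \<le> card (?\<tau> ` (tile m L \<times> Q) \<union> V \<union> (\<Union>j\<in>{..<L}. {y \<in> X. (T ^^ j) y \<in> B}))"
    using finX finQ by (intro card_mono finite_UnI finite_imageI finite_cartesian_product finite_UN_I)
      (simp_all add: card_tile V_def)
  also have "\<dots> \<le> card (?\<tau> ` (tile m L \<times> Q)) + card V + card (\<Union>j\<in>{..<L}. {y \<in> X. (T ^^ j) y \<in> B})"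
    by (intro order_trans[OF card_Un_le] add_right_mono card_Un_le)
  also have "card V \<le> nat (int m - int g) ^ R * nat (n div int m ^ R + 1)"
    using card_never_hit_le[of "int m" n "int g" R] m n g by (simp add: V_def X_def T_def K_def)
  also have "card (\<Union>j\<in>{..<L}. {y \<in> X. (T ^^ j) y \<in> B}) \<le> card {..<L} * card B"
  proof (rule card_UN_le_mult)
    show "card {y \<in> X. (T ^^ j) y \<in> B} \<le> card B" for j
      by (rule card_inj_on_le[OF inj_on_subset[OF T_inj]]) (use finB in auto)
  qed simp
  also have "card B \<le> nat (C + 1) * nat (2 * M + 1)"
    unfolding B_def using C n M by (rule card_split_cells_le)
  also have "nat (C + 1) * nat (2 * M + 1) = (m ^ R + 1) * (2 * m ^ L + 1)"
    by (simp add: C_def M_def nat_add_distrib nat_mult_distrib nat_power_eq)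
  also have "nat (int m - int g) = m - g" by simp
  finally have "nat n \<le> card (?\<tau> ` (tile m L \<times> Q))
       + (m - g) ^ R * nat (n div int m ^ R + 1) + L * ((m ^ R + 1) * (2 * m ^ L + 1))"
    by (simp add: X_def)
  with finQ bound1 show ?thesis by (rule that)
qed

text \<open>Prepares the rotation, which needs a number of tiles divisible by
  \<open>card P ^ (k - 1)\<close>, and the transfer, which needs a total size of at most
  \<open>n\<close>. Surplus tiles are dropped.\<close>

lemma trim_tiles:
  assumes fin: "finite P" "finite Q" and K: "K > 0"
    and le: "card P * card Q \<le> N + e"
  obtains Q' t where "Q' \<subseteq> Q" "card Q' = K * t" "card P * card Q' \<le> N"
    "card (\<tau> ` (P \<times> Q)) \<le> card (\<tau> ` (P \<times> Q')) + e + card P * K"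
proof (cases "card P = 0")
  case True
  then show ?thesis using that[of "{}" 0] fin by simp
next
  case False
  define p where "p = card P"
  have p: "p > 0" using False by (simp add: p_def)
  define r where "r = min (card Q) (N div p)"
  define t where "t = r div K"
  have "K * t \<le> r" by (simp add: t_def)
  then have "K * t \<le> card Q" by (simp add: r_def)
  then obtain Q' where Q': "Q' \<subseteq> Q" "card Q' = K * t" "finite Q'"
    by (rule obtain_subset_with_card_n)
  have "p * (K * t) \<le> p * (N div p)" using \<open>K * t \<le> r\<close> by (intro mult_le_mono2) (simp add: r_def)
  also have "\<dots> \<le> N" by simp
  finally have 1: "p * (K * t) \<le> N" .
  have "r < K * t + K" unfolding t_def using K dividend_less_times_div[of K r] by simp
  \<comment> \<open>The spare unit pays for the rounding in \<open>N div p\<close>.\<close>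
  then have rK: "r + 1 \<le> K * t + K" by simp
  have 2: "p * card Q \<le> p * (K * t) + e + p * K"
  proof (cases "card Q \<le> N div p")
    case True
    then have "card Q \<le> K * t + K" using rK by (simp add: r_def)
    then have "p * card Q \<le> p * (K * t + K)" by (rule mult_le_mono2)
    then show ?thesis by (simp add: distrib_left)
  next
    case False
    then have "p * (N div p + 1) \<le> p * (K * t + K)" using rK by (intro mult_le_mono2) (simp add: r_def)
    moreover have "N < p * (N div p) + p" using dividend_less_times_div[OF p, of N] by simp
    ultimately show ?thesis using le by (simp add: distrib_left p_def)
  qed
  have "\<tau> ` (P \<times> Q) \<subseteq> \<tau> ` (P \<times> Q') \<union> \<tau> ` (P \<times> (Q - Q'))" by auto
  then have "card (\<tau> ` (P \<times> Q)) \<le> card (\<tau> ` (P \<times> Q') \<union> \<tau> ` (P \<times> (Q - Q')))"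
    using fin Q' by (intro card_mono) auto
  also have "\<dots> \<le> card (\<tau> ` (P \<times> Q')) + card (\<tau> ` (P \<times> (Q - Q')))" by (rule card_Un_le)
  also have "card (\<tau> ` (P \<times> (Q - Q'))) \<le> card (P \<times> (Q - Q'))"
    using fin by (intro card_image_le) auto
  also have "card (P \<times> (Q - Q')) = p * card Q - p * (K * t)"
    using Q' by (simp add: card_cartesian_product card_Diff_subset p_def diff_mult_distrib2)
  finally have "card (\<tau> ` (P \<times> Q)) \<le> card (\<tau> ` (P \<times> Q')) + e + card P * K"
    using 2 by (simp add: p_def)
  then show ?thesis using that[of Q' t] Q' 1 by (simp add: p_def)
qed

section \<open>Choice of parameters\<close>

lemma sum_decr_digit:
  fixes c u :: "nat \<Rightarrow> nat"
  assumes "j < L" "c j \<noteq> 0"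
  shows "(\<Sum>i<L. c i * u i) = (\<Sum>i<L. (c(j := c j - 1)) i * u i) + u j"
proof -
  have "(\<Sum>i\<in>{..<L} - {j}. (c(j := c j - 1)) i * u i) = (\<Sum>i\<in>{..<L} - {j}. c i * u i)"
    by (rule sum.cong) auto
  then show ?thesis
    using assms by (cases "c j") (simp_all add: sum.remove[of "{..<L}" j])
qed

text \<open>The losses \<open>n / m\<close> and \<open>n / L\<close> come from tile points where
  \<open>\<alpha>\<close> or \<open>\<beta>\<close> is undefined. The other terms come from covering
  and trimming, with the factor \<open>4\<close> of \<open>transfer_rotation\<close>.\<close>

lemma approximate_permutation_exists:
  fixes n :: int and m L R g k :: nat
  assumes m: "m > 0" and L: "L > 0" and n: "n > 0" and g: "g \<le> m" and k: "k \<ge> 3"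
    and coprime: "coprime (int m) n"
  obtains f where "f permutes {0..<n}" "f ^^ k = id"
    "nat n \<le> card {x \<in> {0..<n}. f ((x + 1) mod n) = int m * f x mod n} + nat n div m + nat n div L
       + 4 * ((m - g) ^ R * nat (n div int m ^ R + 1) + L * ((m ^ R + 1) * (2 * m ^ L + 1))
            + L * L * (g * nat (n div int m + 1)) + (m ^ L * L) ^ k)"
proof -
  obtain v where v: "[v * int m = 1] (mod n)"
    using cong_solve_coprime_int[OF coprime] by (auto simp: mult.commute)
  obtain Q0 where Q0: "finite Q0"
    "card (tile m L) * card Q0 \<le> nat n + L * L * (g * nat (n div int m + 1))"
    "nat n \<le> card (tile_point m L n v ` (tile m L \<times> Q0))
       + (m - g) ^ R * nat (n div int m ^ R + 1) + L * ((m ^ R + 1) * (2 * m ^ L + 1))"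
    using tile_covering_exists[OF m L n g v] .
  define P where "P = tile m L"
  have finP: "finite P" and cP: "card P = m ^ L * L" "card P > 0"
    using m L by (simp_all add: P_def card_tile)
  define \<tau> where "\<tau> = tile_point m L n v"
  have "card P ^ (k - 1) > 0" using cP(2) by (rule zero_less_power)
  from trim_tiles[OF finP Q0(1) this Q0(2)[folded P_def]]
  obtain Q t where Q: "Q \<subseteq> Q0" "card Q = card P ^ (k - 1) * t" "card P * card Q \<le> nat n"
    "card (\<tau> ` (P \<times> Q0)) \<le> card (\<tau> ` (P \<times> Q)) + L * L * (g * nat (n div int m + 1)) + card P * card P ^ (k - 1)"
    by metis
  have finQ: "finite Q" using Q(1) Q0(1) by (rule finite_subset)
  \<comment> \<open>\<open>\<alpha>\<close> is defined where lowering the digit at the current level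
    causes no borrow, \<open>\<beta>\<close> where there is a lower level.\<close>
  define A where "A = {p \<in> P. fst p (snd p) \<noteq> 0}"
  define B where "B = {p \<in> P. snd p \<noteq> 0}"
  define \<alpha> :: "(nat \<Rightarrow> nat) \<times> nat \<Rightarrow> _" where "\<alpha> = (\<lambda>(c, j). (c(j := c j - 1), j))"
  define \<beta> :: "(nat \<Rightarrow> nat) \<times> nat \<Rightarrow> _" where "\<beta> = (\<lambda>(c, j). (c, j - 1))"
  have P: "(c, j) \<in> P \<longleftrightarrow> c \<in> {..<L} \<rightarrow>\<^sub>E {..<m} \<and> j < L" for c j by (simp add: P_def tile_def)
  have upd: "c(j := d) \<in> {..<L} \<rightarrow>\<^sub>E {..<m}" if "c \<in> {..<L} \<rightarrow>\<^sub>E {..<m}" "j < L" "d < m" for c j d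
    using that by (auto simp: PiE_iff extensional_def)
  have A_sub: "A \<subseteq> P" and B_sub: "B \<subseteq> P" by (auto simp: A_def B_def)
  have \<alpha>_inj: "inj_on \<alpha> A"
  proof (rule inj_onI, clarsimp simp: A_def \<alpha>_def)
    fix c c' :: "nat \<Rightarrow> nat" and j
    assume eq: "c(j := c j - Suc 0) = c'(j := c' j - Suc 0)" and nz: "0 < c j" "0 < c' j"
    have "c i = c' i" for i
      using fun_cong[OF eq, of i] nz by (cases "i = j") auto
    then show "c = c'" by auto
  qed
  have \<alpha>_P: "\<alpha> ` A \<subseteq> P"
  proof (clarsimp simp: A_def \<alpha>_def P)
    fix c j assume c: "c \<in> {..<L} \<rightarrow>\<^sub>E {..<m}" "j < L"
    then have "c j < m" by auto
    with c show "c(j := c j - Suc 0) \<in> {..<L} \<rightarrow>\<^sub>E {..<m}" by (intro upd) auto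
  qed
  have \<beta>_inj: "inj_on \<beta> B" by (auto simp: inj_on_def B_def \<beta>_def)
  have \<beta>_P: "\<beta> ` B \<subseteq> P" by (auto simp: B_def \<beta>_def P)
  \<comment> \<open>The digit sum falls by one under \<open>\<alpha>\<close> and the level
    \<open>snd\<close> under \<open>\<beta>\<close>: these are the two counters. The factor
    \<open>1\<close> fits \<open>sum_decr_digit\<close>.\<close>
  define h :: "(nat \<Rightarrow> nat) \<times> nat \<Rightarrow> nat" where "h p = (\<Sum>i<L. fst p i * 1)" for p
  have h\<alpha>: "h p = Suc (h (\<alpha> p))" if "p \<in> A" for p
    using that sum_decr_digit[of "snd p" L "fst p" "\<lambda>_. 1"]
    by (cases p) (simp add: A_def P h_def \<alpha>_def)
  obtain F where F: "bij_betw F (P \<times> Q) (P \<times> Q)" "\<And>z. z \<in> P \<times> Q \<Longrightarrow> (F ^^ k) z = z"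
    "\<And>p q p' q'. \<lbrakk>p \<in> A; q \<in> Q; F (p, q) = (p', q'); p' \<in> B\<rbrakk> \<Longrightarrow> F (\<alpha> p, q) = (\<beta> p', q')"
  proof (rule twisted_rotation_exists[OF finP k A_sub \<alpha>_inj \<alpha>_P B_sub \<beta>_inj \<beta>_P, of h snd Q t])
    show "snd (\<alpha> p) = snd p" for p by (cases p) (simp add: \<alpha>_def)
    show "h (\<beta> p) = h p" for p by (cases p) (simp add: h_def \<beta>_def)
    show "snd p = Suc (snd (\<beta> p))" if "p \<in> B" for p using that by (cases p) (simp add: B_def \<beta>_def)
  qed (use h\<alpha> finQ Q in auto)
  \<comment> \<open>Lowering digit \<open>j\<close> moves the position in the cell by
    \<open>m ^ j\<close>, and \<open>v ^ j * m ^ j\<close> is \<open>1\<close> modulo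
    \<open>n\<close>.\<close>
  have \<tau>\<alpha>: "\<tau> (\<alpha> p, q) = (\<tau> (p, q) + 1) mod n" if p: "p \<in> A" for p q
  proof -
    obtain c j where cj: "p = (c, j)" by force
    define d where "d = c(j := c j - 1)"
    define u where "u = q * int m ^ L + int m ^ L - 1 - int (\<Sum>i<L. c i * m ^ i)"
    have "(\<Sum>i<L. c i * m ^ i) = (\<Sum>i<L. d i * m ^ i) + m ^ j"
      using p sum_decr_digit[of j L c "\<lambda>i. m ^ i"] by (simp add: A_def P cj d_def)
    then have "q * int m ^ L + int m ^ L - 1 - int (\<Sum>i<L. d i * m ^ i) = u + int m ^ j"
      by (simp only: u_def of_nat_add of_nat_power)
    then have "\<tau> (\<alpha> p, q) = v ^ j * (u + int m ^ j) mod n"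
      by (simp only: \<tau>_def tile_point_def \<alpha>_def cj d_def prod.case)
    also have "v ^ j * (u + int m ^ j) = v ^ j * u + (v * int m) ^ j"
      by (simp add: distrib_left power_mult_distrib)
    also have "[v ^ j * u + (v * int m) ^ j = v ^ j * u + 1 ^ j] (mod n)"
      by (intro cong_add cong_pow v cong_refl)
    then have "(v ^ j * u + (v * int m) ^ j) mod n = (v ^ j * u + 1) mod n" by (simp add: cong_def)
    also have "\<dots> = (\<tau> (p, q) + 1) mod n"
      by (simp only: \<tau>_def tile_point_def cj u_def prod.case mod_add_left_eq)
    finally show ?thesis .
  qed
  have \<tau>\<beta>: "\<tau> (\<beta> p, q) = int m * \<tau> (p, q) mod n" if p: "p \<in> B" for p q
  proof -
    obtain c j where cj: "p = (c, Suc j)" using p by (cases p; cases "snd p") (auto simp: B_def)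
    define u where "u = q * int m ^ L + int m ^ L - 1 - int (\<Sum>i<L. c i * m ^ i)"
    have "int m * \<tau> (p, q) mod n = int m * (v ^ Suc j * u mod n) mod n"
      by (simp only: \<tau>_def tile_point_def cj u_def prod.case)
    also have "\<dots> = (v * int m) * (v ^ j * u) mod n"
      by (simp add: mod_mult_right_eq mult.assoc mult.left_commute)
    also have "[(v * int m) * (v ^ j * u) = 1 * (v ^ j * u)] (mod n)"
      by (intro cong_mult v cong_refl)
    then have "(v * int m) * (v ^ j * u) mod n = v ^ j * u mod n" by (simp add: cong_def)
    also have "\<dots> = \<tau> (\<beta> p, q)"
      by (simp only: \<tau>_def tile_point_def \<beta>_def cj u_def prod.case diff_Suc_1)
    finally show ?thesis by simp
  qed
  have \<tau>_X: "\<tau> ` (P \<times> Q) \<subseteq> {0..<n}"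
    using n by (auto simp: \<tau>_def tile_point_def)
  obtain f where f: "f permutes {0..<n}" "f ^^ k = id"
    "4 * card (\<tau> ` (P \<times> Q)) \<le> card {x \<in> {0..<n}. f ((x + 1) mod n) = int m * f x mod n}
       + 3 * card (P \<times> Q) + card (P - A) * card Q + card (P - B) * card Q"
  proof (rule transfer_rotation[OF _ finP finQ A_sub \<alpha>_inj \<alpha>_P B_sub \<beta>_inj \<beta>_P \<tau>_X _ _ F,
        where S = "\<lambda>x. (x + 1) mod n" and T = "\<lambda>x. int m * x mod n"])
    show "card (P \<times> Q) \<le> card {0..<n}" using Q(3) by (simp add: card_cartesian_product)
  qed (use \<tau>\<alpha> \<tau>\<beta> in auto)
  \<comment> \<open>Outside \<open>A\<close> the digit at the current level is \<open>0\<close>;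
    overwriting it by any of \<open>m\<close> values is injective, so \<open>P - A\<close> is at
    most a fraction \<open>1 / m\<close> of \<open>P\<close>.\<close>
  have "card ((P - A) \<times> {..<m}) \<le> card P"
  proof (rule card_inj_on_le[of "\<lambda>((c, j), d). (c(j := d), j)"])
    show "inj_on (\<lambda>((c, j), d). (c(j := d), j)) ((P - A) \<times> {..<m})"
    proof (rule inj_onI)
      fix x y assume x: "x \<in> (P - A) \<times> {..<m}" and y: "y \<in> (P - A) \<times> {..<m}"
        and eq: "(\<lambda>((c, j), d). (c(j := d), j)) x = (\<lambda>((c, j), d). (c(j := d), j)) y"
      obtain c j d c' j' d' where xy: "x = ((c, j), d)" "y = ((c', j'), d')" by (metis surj_pair)
      have j: "j' = j" and upd_eq: "c(j := d) = c'(j := d')" using eq by (auto simp: xy)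
      have z: "c j = 0" "c' j = 0" using x y by (auto simp: xy A_def j)
      have "c i = c' i" for i
        using fun_cong[OF upd_eq, of i] z by (cases "i = j") auto
      then show "x = y" using fun_cong[OF upd_eq, of j] by (auto simp: xy j)
    qed
    show "(\<lambda>((c, j), d). (c(j := d), j)) ` ((P - A) \<times> {..<m}) \<subseteq> P"
      using upd by (auto simp: P)
  qed (rule finP)
  then have "m * card (P - A) \<le> card P" by (simp add: card_cartesian_product mult.commute)
  then have "m * card (P - A) * card Q \<le> card P * card Q" by (rule mult_le_mono1)
  then have "m * (card (P - A) * card Q) \<le> nat n" using Q(3) unfolding mult.assoc by (rule order_trans)
  then have bad_A: "card (P - A) * card Q \<le> nat n div m"
    using m by (simp add: less_eq_div_iff_mult_less_eq mult.commute)
  have "card ((P - B) \<times> {..<L}) \<le> card P"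
    by (rule card_inj_on_le[of "\<lambda>((c, j), d). (c, d)"])
      (use finP in \<open>auto simp: inj_on_def B_def P\<close>)
  then have "L * card (P - B) \<le> card P" by (simp add: card_cartesian_product mult.commute)
  then have "L * card (P - B) * card Q \<le> card P * card Q" by (rule mult_le_mono1)
  then have "L * (card (P - B) * card Q) \<le> nat n" using Q(3) unfolding mult.assoc by (rule order_trans)
  then have bad_B: "card (P - B) * card Q \<le> nat n div L"
    using L by (simp add: less_eq_div_iff_mult_less_eq mult.commute)
  have pow: "card P * card P ^ (k - 1) = (m ^ L * L) ^ k"
    using k by (simp add: cP power_eq_if)
  have count: "N \<le> good + x + y + 4 * (a + b + e + z)"
    if "4 * I \<le> good + 3 * pq + pa + pb" "pa \<le> x" "pb \<le> y" "pq \<le> N" "I0 \<le> I + e + z" "N \<le> I0 + a + b"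
    for N good x y a b e z I I0 pq pa pb :: nat
  proof -
    have "4 * N \<le> 4 * I + 4 * (a + b + e + z)" using that(5,6) by simp
    then show ?thesis using that(1-4) by linarith
  qed
  show ?thesis
    by (rule that[OF f(1,2) count[OF f(3)[unfolded card_cartesian_product] bad_A bad_B Q(3)
          Q(4)[unfolded pow] Q0(3)[folded P_def \<tau>_def]]])
qed

section \<open>Asymptotics and constants\<close>

lemma power_le_exp_eventually:
  fixes \<eta> :: real and c :: nat
  assumes "\<eta> > 0"
  obtains X where "\<And>x. x \<ge> X \<Longrightarrow> x ^ c \<le> \<eta> * exp x"
proof -
  have "eventually (\<lambda>x::real. x ^ c / exp x < \<eta>) at_top"
    using tendsto_power_div_exp_0 assms by (rule order_tendstoD(2))
  then obtain X where "\<And>x. x \<ge> X \<Longrightarrow> x ^ c / exp x < \<eta>"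
    by (auto simp: eventually_at_top_linorder)
  then have "x ^ c \<le> \<eta> * exp x" if "x \<ge> X" for x
    using that by (simp add: pos_divide_less_eq less_imp_le)
  then show ?thesis using that by blast
qed

text \<open>Gathers the error terms without a factor \<open>n\<close> into one power of
  \<open>m\<close>, with a constant depending only on \<open>L\<close> and \<open>k\<close>.\<close>

lemma overhead_le_power:
  fixes m L R k :: nat
  assumes m: "m > 0" and L: "L > 0" and k: "k > 0"
  shows "m ^ R + L * ((m ^ R + 1) * (2 * m ^ L + 1)) + L * L * m + (m ^ L * L) ^ k
    \<le> (1 + 6 * L + L * L + L ^ k) * m ^ (R + L * k)"
proof -
  define e where "e = R + L * k"
  have Lk: "L \<le> L * k" using k by simp
  have mono: "m ^ i \<le> m ^ e" if "i \<le> e" for i using m that by (intro power_increasing) auto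
  have one: "1 \<le> m ^ i" for i using m by simp
  have "(m ^ R + 1) * (2 * m ^ L + 1) \<le> (2 * m ^ R) * (3 * m ^ L)"
    using one[of R] one[of L] by (intro mult_le_mono) simp_all
  also have "\<dots> = 6 * m ^ (R + L)" by (simp add: power_add)
  also have "\<dots> \<le> 6 * m ^ e" using Lk by (intro mult_le_mono2 mono) (simp add: e_def)
  finally have 1: "L * ((m ^ R + 1) * (2 * m ^ L + 1)) \<le> L * (6 * m ^ e)" by (rule mult_le_mono2)
  have 2: "L * L * m \<le> L * L * m ^ e"
    using mono[of 1] L Lk by (intro mult_le_mono2) (simp add: e_def)
  have "L ^ k * m ^ (L * k) \<le> L ^ k * m ^ e" by (intro mult_le_mono2 mono) (simp add: e_def)
  then have 3: "(m ^ L * L) ^ k \<le> L ^ k * m ^ e"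
    by (simp add: power_mult_distrib power_mult mult.commute)
  have 4: "m ^ R \<le> m ^ e" by (intro mono) (simp add: e_def)
  have "(1 + 6 * L + L * L + L ^ k) * m ^ e = m ^ e + L * (6 * m ^ e) + L * L * m ^ e + L ^ k * m ^ e"
    by (simp add: algebra_simps)
  then show ?thesis unfolding e_def[symmetric] by (simp only:) (intro add_mono 1 2 3 4)
qed

text \<open>Once \<open>L\<close>, \<open>\<delta>\<close> and \<open>R\<close> are fixed, the
  losses are a small share of \<open>n\<close> plus a polynomial in \<open>m\<close>, which
  \<open>m < ln n\<close> makes negligible.\<close>

lemma approximate_permutation_eventually:
  fixes \<epsilon> :: real and k :: nat
  assumes \<epsilon>: "\<epsilon> > 0" and k: "k \<ge> 3"
  shows "\<exists>M X. \<forall>m n. coprime (int m) n \<longrightarrow> real m \<ge> M \<longrightarrow> real m < ln (real_of_int n) \<longrightarrow>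
    ln (real_of_int n) \<ge> X \<longrightarrow> n > 0 \<longrightarrow> (\<exists>f. f permutes {0..<n} \<and> f ^^ k = id \<and>
      real (card {x \<in> {0..<n}. f ((x + 1) mod n) = int m * f x mod n}) \<ge> (1 - \<epsilon>) * real_of_int n)"
proof -
  define L where "L = nat \<lceil>8 / \<epsilon>\<rceil>"
  have "0 < 8 / \<epsilon>" using \<epsilon> by simp
  then have L: "L > 0" "real L \<ge> 8 / \<epsilon>" by (simp_all add: L_def)
  \<comment> \<open>The overlap caused by marks is about \<open>2 * \<delta> * L ^ 2\<close> of
    \<open>n\<close>, here at most \<open>\<epsilon> / 32\<close>.\<close>
  define \<delta> where "\<delta> = min \<epsilon> 1 / (64 * real L ^ 2)"
  have \<delta>: "\<delta> > 0" "L * L * \<delta> \<le> \<epsilon> / 64" using \<epsilon> L by (simp_all add: \<delta>_def power2_eq_square)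
  have "64 * real L ^ 2 \<ge> 1" using L by (simp add: order_trans[of 1 "real L ^ 2"])
  then have \<delta>1: "\<delta> \<le> 1" by (auto simp: \<delta>_def divide_le_eq min_le_iff_disj)
  \<comment> \<open>About \<open>(1 - \<delta>) ^ R\<close> of all points meet no mark within
    \<open>R\<close> steps.\<close>
  obtain R where R: "(1 - \<delta>) ^ R < \<epsilon> / 64"
    using real_arch_pow_inv[of "\<epsilon> / 64" "1 - \<delta>"] \<epsilon> \<delta> by auto
  define C where "C = 1 + 6 * L + L * L + L ^ k"
  have C: "C > 0" by (simp add: C_def)
  then have "\<epsilon> / (16 * real C) > 0" using \<epsilon> by simp
  then obtain X where X: "\<And>x. x \<ge> X \<Longrightarrow> x ^ (R + L * k) \<le> \<epsilon> / (16 * real C) * exp x"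
    using power_le_exp_eventually[of "\<epsilon> / (16 * real C)" "R + L * k"] by metis
  \<comment> \<open>The first bound controls the loss \<open>n / m\<close>; the second gives
    \<open>\<delta> * m \<ge> 1\<close>, so that rounding up to \<open>g\<close> at most doubles
    \<open>\<delta> * m\<close>.\<close>
  define M where "M = max (8 / \<epsilon>) (1 / \<delta>)"
  show ?thesis
  proof (rule exI[of _ M], rule exI[of _ X], intro allI impI)
    fix m :: nat and n :: int
    assume cop: "coprime (int m) n" and m: "real m \<ge> M" and mn: "real m < ln (real_of_int n)"
      and nX: "ln (real_of_int n) \<ge> X" and n: "n > 0"
    define N where "N = real_of_int n"
    have N: "N > 0" using n by (simp add: N_def)
    have "M > 0" using \<epsilon> by (simp add: M_def less_max_iff_disj)
    then have m0: "m > 0" using m by simp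
    have md: "real m * \<delta> \<ge> 1" and me: "real m \<ge> 8 / \<epsilon>"
      using m \<delta> by (simp_all add: M_def divide_le_eq)
    define g where "g = nat \<lceil>\<delta> * real m\<rceil>"
    have g_lo: "\<delta> * real m \<le> real g" unfolding g_def by linarith
    have \<delta>m: "\<delta> * real m \<ge> 1" using md by (simp add: mult.commute)
    have "real g \<le> \<delta> * real m + 1" using \<delta>m unfolding g_def by linarith
    then have g_hi: "real g \<le> 2 * \<delta> * real m" using \<delta>m by simp
    have "\<delta> * real m \<le> real m" using \<delta>1 by (simp add: mult_left_le_one_le \<delta> less_imp_le)
    then have gm: "g \<le> m" by (simp add: g_def nat_le_iff ceiling_le_iff)
    obtain f where f: "f permutes {0..<n}" "f ^^ k = id"
      "nat n \<le> card {x \<in> {0..<n}. f ((x + 1) mod n) = int m * f x mod n} + nat n div m + nat n div L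
       + 4 * ((m - g) ^ R * nat (n div int m ^ R + 1) + L * ((m ^ R + 1) * (2 * m ^ L + 1))
            + L * L * (g * nat (n div int m + 1)) + (m ^ L * L) ^ k)"
      using approximate_permutation_exists[OF m0 L(1) n gm k cop, of R] by blast
    define G where "G = card {x \<in> {0..<n}. f ((x + 1) mod n) = int m * f x mod n}"
    have quot: "real (nat (n div int d + 1)) \<le> N / d + 1" if "d > 0" for d :: nat
    proof -
      have "0 \<le> n div int d" using n that by (simp add: pos_imp_zdiv_nonneg_iff)
      then have "real (nat (n div int d + 1)) = real_of_int (n div int d) + 1" by simp
      also have "\<dots> \<le> N / d + 1" using real_of_int_div4[of n "int d"] by (simp add: N_def)
      finally show ?thesis .
    qed
    have V: "real ((m - g) ^ R * nat (n div int m ^ R + 1)) \<le> \<epsilon> / 64 * N + real (m ^ R)"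
    proof -
      have "real (m - g) ^ R \<le> ((1 - \<delta>) * real m) ^ R"
        using g_lo gm by (intro power_mono) (simp_all add: of_nat_diff algebra_simps)
      then have "real (m - g) ^ R \<le> (1 - \<delta>) ^ R * real m ^ R" by (simp add: power_mult_distrib)
      then have "real ((m - g) ^ R * nat (n div int m ^ R + 1)) \<le> (1 - \<delta>) ^ R * real m ^ R * (N / real m ^ R + 1)"
        using quot[of "m ^ R"] m0 \<delta>1 unfolding of_nat_mult of_nat_power
        by (intro mult_mono) simp_all
      also have "\<dots> = (1 - \<delta>) ^ R * N + (1 - \<delta>) ^ R * real m ^ R" using m0 by (simp add: field_simps)
      also have "\<dots> \<le> \<epsilon> / 64 * N + 1 * real m ^ R"
        using R N \<delta> \<delta>1 by (intro add_mono mult_right_mono) (auto simp: power_le_one)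
      finally show ?thesis by simp
    qed
    have E: "real (L * L * (g * nat (n div int m + 1))) \<le> \<epsilon> / 32 * N + real (L * L * m)"
    proof -
      have "real g * real (nat (n div int m + 1)) \<le> real g * (N / m + 1)"
        using quot[OF m0] by (rule mult_left_mono) simp
      also have "\<dots> = real g / m * N + real g" using m0 by (simp add: field_simps)
      also have "\<dots> \<le> 2 * \<delta> * N + real m"
        using g_hi gm m0 N by (intro add_mono mult_right_mono) (simp_all add: divide_le_eq)
      finally have "real (L * L) * (real g * real (nat (n div int m + 1))) \<le> real (L * L) * (2 * \<delta> * N + real m)"
        by (rule mult_left_mono) simp
      moreover have "(L * L * \<delta>) * (2 * N) \<le> \<epsilon> / 64 * (2 * N)"
        using \<delta>(2) N by (intro mult_right_mono) simp_all
      ultimately show ?thesis by (simp add: algebra_simps)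
    qed
    \<comment> \<open>The rounding terms \<open>m ^ R\<close> and \<open>L * L * m\<close> left over
      from \<open>V\<close> and \<open>E\<close> join the other powers of \<open>m\<close>.\<close>
    have "real (m ^ R + L * ((m ^ R + 1) * (2 * m ^ L + 1)) + L * L * m + (m ^ L * L) ^ k)
        \<le> real (C * m ^ (R + L * k))"
      unfolding C_def of_nat_le_iff using m0 L k by (intro overhead_le_power) auto
    also have "\<dots> \<le> real C * ln N ^ (R + L * k)"
      using mn unfolding of_nat_mult of_nat_power N_def by (intro mult_left_mono power_mono) auto
    also have "\<dots> \<le> real C * (\<epsilon> / (16 * real C) * exp (ln N))"
      using X[of "ln N"] nX by (intro mult_left_mono) (simp_all add: N_def)
    also have "\<dots> = \<epsilon> / 16 * N" using N C by simp
    finally have O: "real (m ^ R + L * ((m ^ R + 1) * (2 * m ^ L + 1)) + L * L * m + (m ^ L * L) ^ k)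
        \<le> \<epsilon> / 16 * N" .
    have share: "real (nat n div d) \<le> \<epsilon> / 8 * N" if "real d \<ge> 8 / \<epsilon>" for d :: nat
    proof -
      have "real (nat n div d) \<le> N / d" using of_nat_div_le_of_nat[of "nat n" d, where ?'a = real] n by (simp add: N_def)
      also have "\<dots> \<le> N / (8 / \<epsilon>)" using that N \<epsilon> \<open>0 < 8 / \<epsilon>\<close> by (intro divide_left_mono mult_pos_pos) linarith+
      finally show ?thesis by (simp add: mult.commute)
    qed
    have "N \<le> real G + real (nat n div m) + real (nat n div L)
       + 4 * (real ((m - g) ^ R * nat (n div int m ^ R + 1)) + real (L * ((m ^ R + 1) * (2 * m ^ L + 1)))
            + real (L * L * (g * nat (n div int m + 1))) + real ((m ^ L * L) ^ k))"
    proof -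
      have "real (nat n) = N" using n by (simp add: N_def)
      moreover note of_nat_mono[OF f(3), where 'a = real, folded G_def]
      ultimately show ?thesis by (simp only: of_nat_add of_nat_mult[of 4] of_nat_numeral)
    qed
    \<comment> \<open>The budget in units of \<open>y = \<epsilon> * N\<close>: 1/8 + 1/8 + 4 *
      (1/64 + 1/32 + 1/16) = 11/16.\<close>
    moreover have "x \<le> good + y"
      if "x \<le> good + s + t + 4 * (a + b + c + d)" "s \<le> y / 8" "t \<le> y / 8"
        "a \<le> y / 64 + u" "c \<le> y / 32 + w" "u + b + w + d \<le> y / 16" "y > 0"
      for x y good s t a b c d u w :: real
    proof -
      have "4 * (a + b + c + d) \<le> 4 * (y / 64 + y / 32 + y / 16)" using that(4-6) by simp
      then show ?thesis using that(1-3,7) by simp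
    qed
    moreover have "\<epsilon> * N > 0" using \<epsilon> N by simp
    ultimately have "N \<le> real G + \<epsilon> * N"
      using V[unfolded times_divide_eq_left] E[unfolded times_divide_eq_left]
        O[unfolded of_nat_add times_divide_eq_left] share[OF me, unfolded times_divide_eq_left]
        share[OF L(2), unfolded times_divide_eq_left] by blast
    then have "(1 - \<epsilon>) * N \<le> real G" by (simp add: left_diff_distrib)
    then show "\<exists>f. f permutes {0..<n} \<and> f ^^ k = id \<and>
      real (card {x \<in> {0..<n}. f ((x + 1) mod n) = int m * f x mod n}) \<ge> (1 - \<epsilon>) * real_of_int n"
      using f(1,2) by (auto simp: G_def N_def)
  qed
qed

theorem theorem1p3:
  "\<forall>\<epsilon>::real. \<forall>k::nat. \<epsilon> > 0 \<longrightarrow> k \<ge> 3 \<longrightarrow>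
     (\<exists>N::nat. \<forall>(m::int) (n::int).
        coprime m n \<longrightarrow> n > int N \<longrightarrow>
        ln (ln (real_of_int n)) < real_of_int m \<longrightarrow> real_of_int m < ln (real_of_int n) \<longrightarrow>
        (\<exists>f. f permutes carrier (residue_ring n) \<and> f ^^ k = id \<and>
             real (card (twisted_shift_points n m f)) \<ge> (1 - \<epsilon>) * real_of_int n))"
proof (intro allI impI)
  fix \<epsilon> :: real and k :: nat
  assume "\<epsilon> > 0" "k \<ge> 3"
  then obtain M X where MX: "\<forall>m n. coprime (int m) n \<longrightarrow> real m \<ge> M \<longrightarrow> real m < ln (real_of_int n) \<longrightarrow>
    ln (real_of_int n) \<ge> X \<longrightarrow> n > 0 \<longrightarrow> (\<exists>f. f permutes {0..<n} \<and> f ^^ k = id \<and>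
      real (card {x \<in> {0..<n}. f ((x + 1) mod n) = int m * f x mod n}) \<ge> (1 - \<epsilon>) * real_of_int n)"
    using approximate_permutation_eventually by blast
  \<comment> \<open>As \<open>ln n \<ge> exp (max M 1)\<close>, the lower bound on \<open>m\<close>
    forces \<open>m \<ge> M\<close>; the \<open>1\<close> makes \<open>m\<close> positive, so that
    \<open>nat m\<close> loses nothing.\<close>
  define Y where "Y = max X (exp (max M 1))"
  define N where "N = nat \<lceil>exp Y\<rceil>"
  show "\<exists>N::nat. \<forall>(m::int) (n::int).
        coprime m n \<longrightarrow> n > int N \<longrightarrow>
        ln (ln (real_of_int n)) < real_of_int m \<longrightarrow> real_of_int m < ln (real_of_int n) \<longrightarrow>
        (\<exists>f. f permutes carrier (residue_ring n) \<and> f ^^ k = id \<and>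
             real (card (twisted_shift_points n m f)) \<ge> (1 - \<epsilon>) * real_of_int n)"
  proof (intro exI[of _ N] allI impI)
    fix m n :: int
    assume cop: "coprime m n" and nN: "n > int N" and lo: "ln (ln (real_of_int n)) < real_of_int m"
      and hi: "real_of_int m < ln (real_of_int n)"
    have n: "exp Y \<le> real_of_int n" using nN unfolding N_def by linarith
    then have n0: "real_of_int n > 0" using exp_gt_zero[of Y] by linarith
    have lnY: "Y \<le> ln (real_of_int n)" using n n0 by (simp add: ln_ge_iff)
    then have "exp (max M 1) \<le> ln (real_of_int n)" "X \<le> ln (real_of_int n)" by (simp_all add: Y_def)
    then have "max M 1 \<le> ln (ln (real_of_int n))"
      using exp_gt_zero[of "max M 1"] by (subst ln_ge_iff) linarith+
    then have mM: "M \<le> real_of_int m" "1 \<le> real_of_int m" using lo by linarith+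
    define m' where "m' = nat m"
    have m': "int m' = m" and m'r: "real m' = real_of_int m" using mM by (simp_all add: m'_def)
    have "n > 0" using n0 by simp
    then have "\<exists>f. f permutes {0..<n} \<and> f ^^ k = id \<and>
        real (card {x \<in> {0..<n}. f ((x + 1) mod n) = int m' * f x mod n}) \<ge> (1 - \<epsilon>) * real_of_int n"
      using MX[rule_format, of m' n] cop mM(1) hi \<open>X \<le> ln (real_of_int n)\<close> unfolding m' m'r by blast
    moreover have "carrier (residue_ring n) = {0..<n}" by (auto simp: residue_ring_def)
    moreover have "twisted_shift_points n m f = {x \<in> {0..<n}. f ((x + 1) mod n) = int m' * f x mod n}" for f
      unfolding m' by (auto simp: twisted_shift_points_def residue_ring_def mod_mult_left_eq)
    ultimately show "\<exists>f. f permutes carrier (residue_ring n) \<and> f ^^ k = id \<and>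
             real (card (twisted_shift_points n m f)) \<ge> (1 - \<epsilon>) * real_of_int n"
      by (simp only:)
  qed
qed

end
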